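(* For given $l$, $1\leq l \leq h^+(\alpha)$, and integers $c_1, c_2, c_3$, $c_1', c_2', c_3'$, set \[ C = \sum_{1\leq i\leq 3} c_i B_{li}, \quad \xi = \sum_{1\leq i \leq 3} c_i \overline{\beta}_{li}, \quad C' = \sum_{1\leq i \leq 3} c_i' B_{li}', \quad \xi' = \sum_{1\leq i\leq 3} c_i' \beta_{li}. \] Assume that $\gcd(c_{11}, c_{21}, c_{31}) = 1$, $\gcd(c_{31}', c_{32}', c_{33}') = 1$, and $\xi \xi' \in \mathbb{Z}$, where $c_{ij}$, $c_{ij}'$ are respectively the entries of $C$, $C'$; assume also that $\xi' \in \mathcal{D}$. Then the coset $\Gamma_\infty \gamma \in \Gamma_\infty \backslash \Gamma$ having Plücker coordinates $c_{11}, c_{21}, c_{31}, c_{31}', c_{32}', c_{33}'$ satisfies \[ \gamma \mathfrak{B}_l \begin{pmatrix} \xi^{(1)} & 0 & 0 \\ 0 & \xi^{(2)} & 0 \\ 0 & 0 & \xi^{(3)} \end{pmatrix} = \begin{pmatrix} 1 & \mu_1 + a_1 & * \\ 0 & m_1 & -\mu_2m_1 \\ 0 & 0 & m_1m_2 \end{pmatrix}\mathfrak{B}_1 \quad\text{and}\quad \begin{pmatrix} 1 & \mu_1 + a_1 & * \\ 0 & m_1 & -\mu_2m_1 \\ 0 & 0 & m_1m_2 \end{pmatrix} = \gamma C, \] where $m_1$, $m_2$ are positive integers and $\mu_1\pmod{m_1}$, $\mu_2 \pmod {m_2}$ satisfy $F(\mu_1) \equiv 0 \pmod {m_1}$, $F(\mu_2)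 \equiv 0 \pmod {m_2}$. Conversely, given positive integers $m_1$, $m_2$ with $\gcd(m_1m_2, D) = 1$ and residue classes $\mu_1 \pmod {m_1}$, $\mu_2\pmod {m_2}$ satisfying $F(\mu_1) \equiv 0 \pmod {m_1}$, $F(\mu_2) \equiv 0 \pmod {m_2}$, and $\gcd(m_1, m_2, \mu_1 - \mu_2) = 1$, there exist a unique $l$ and unique integers $c_1,c_2,c_3$, $c_1',c_2',c_3'$ satisfying the assumptions above for which the coset $\Gamma_\infty\gamma$ with Plücker coordinates $c_{11}, c_{21}, c_{31}, c_{31}', c_{32}', c_{33}'$ satisfies the two displayed equations with these $m_1,m_2,\mu_1,\mu_2$.
   Context: Let $d=3$ and $F(X) = X^3 + a_1 X^2 + a_2X + a_3 \in \mathbb{Z}[X]$ be irreducible with discriminant $D$, and let $\alpha$ be a root of $F$, identified with the vector in $\mathbb{C}^3$ of its three complex embeddings. $C_{r_1,r_2}\subset\mathbb{C}^3$ is the set of vectors whose first $r_1$ coordinates are real and whose remaining coordinates come in complex-conjugate pairs ($r_1$ real embeddings, $r_2$ conjugate pairs), and $C^+_{r_1,r_2}$ the subset with positive real coordinates. $h^+(\alpha)$ is the narrow class number of $\mathbb{Z}[\alpha]$; $I_l$ are fixed integral ideal representatives of the narrow classes with $I_1=\mathbb{Z}[\alpha]$, with fixed $\mathbb{Z}$-bases $\{\beta_{l1},\beta_{l2},\beta_{l3}\}$ (for $l=1$: $\{\alpha^2,\alpha,1\}$); $\mathfrak{B}_l$ is the $3\times3$ matrix with $(i,j)$ entry the $j$th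 embedding $\beta_{li}^{(j)}$, with $\mathrm{sign}\det\mathfrak{B}_l=\mathrm{sign}\det\mathfrak{B}_1$. $\{\overline{\beta}_{l1}, \overline{\beta}_{l2},\overline{\beta}_{l3}\}$ is a fixed basis of $I_l^{-1}$; integers $b_{ijkl}$ are defined by $\overline{\beta}_{li}\beta_{lj} = \sum_{k} b_{ijkl} \alpha^{3-k}$ and $B_{li}$ is the matrix $(b_{ijkl})$ with $j$ indexing rows and $k$ columns; integers $b'_{ijkl}$ are defined by $\beta_{li}\alpha^{3-j} = \sum_{k} b'_{ijkl}\beta_{lk}$ and $B'_{li}$ is the matrix $(b'_{ijkl})$ with $j$ indexing rows and $k$ columns. $\mathcal{D}$ is a fixed fundamental domain for the action of the totally positive units of $\mathbb{Z}[\alpha]$ on $C^+_{r_1,r_2}\cap\mathbb{Q}(\alpha)$. $\Gamma=\mathrm{SL}(3,\mathbb{Z})$ and $\Gamma_\infty$ is its subgroup of upper-triangular unipotent matrices. The Plücker coordinates of $\Gamma_\infty\gamma$ are $a,b,c,a',b',c'$ where $(a,b,c)^T$ is the first column of $\gamma^{-1}$ and $(a',b',c')$ the bottom row of $\gamma$; integers with $\gcd(a,b,c)=\gcd(a',b',c')=1$ and $aa'+bb'+cc'=0$ determine a unique such coset.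
   Formalization: In the first half, m_2 is shown positive only when the integer ξξ' is positive; otherwise only m_2 ≠ 0 (m_1 > 0 always). As stated it fails: m_1m_2 = ξξ', which is negative e.g. for l = 1, ξ' a unit in 𝒟 and ξ = −1/ξ'. *)

theory Defs
  imports
    "HOL-Analysis.Analysis"
    "HOL-Computational_Algebra.Computational_Algebra"
    "HOL-Computational_Algebra.Group_Closure"
    "HOL-Number_Theory.Cong"
begin

section \<open>The cubic polynomial and its roots\<close>

definition cubic :: "int \<Rightarrow> int \<Rightarrow> int \<Rightarrow> int poly" where
  "cubic a1 a2 a3 = [:a3, a2, a1, 1:]"

definition cubic_disc :: "int \<Rightarrow> int \<Rightarrow> int \<Rightarrow> int" where
  "cubic_disc a1 a2 a3 =
     a1^2 * a2^2 - 4 * a2^3 - 4 * a1^3 * a3 + 18 * a1 * a2 * a3 - 27 * a3^2"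

lemma cubic_disc_eq_prod_roots:
  fixes x y z :: complex
  assumes "map_poly of_int (cubic a1 a2 a3) = [:-x, 1:] * [:-y, 1:] * [:-z, 1:]"
  shows "of_int (cubic_disc a1 a2 a3) = ((x - y) * (x - z) * (y - z))^2"
proof -
  have "[:of_int a3, of_int a2, of_int a1, 1:] = [:-x, 1:] * [:-y, 1:] * [:-z, 1:]"
    using assms by (simp add: cubic_def map_poly_pCons)
  then have *: "of_int a1 = - (x + y + z)" "of_int a2 = x * y + x * z + y * z"
    "of_int a3 = - (x * y * z)"
    by (simp_all add: algebra_simps)
  have "of_int (cubic_disc a1 a2 a3) =
      (of_int a1)^2 * (of_int a2)^2 - 4 * (of_int a2)^3 - 4 * (of_int a1)^3 * of_int a3
      + 18 * of_int a1 * of_int a2 * of_int a3 - 27 * (of_int a3 :: complex)^2"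
    by (simp add: cubic_disc_def)
  also have "\<dots> = ((x - y) * (x - z) * (y - z))^2"
    unfolding * by algebra
  finally show ?thesis .
qed

text \<open>
  Elements of the cubic field are identified with the vectors of their three embeddings, that is
  with elements of the ring \<open>complex^3\<close> with componentwise operations; in particular
  \<open>of_int n\<close> is the constant vector with all coordinates \<open>n\<close>. Indices have type \<open>3\<close>, in which
  \<open>3 = 0\<close>; the coordinates are listed in the order \<open>1, 2, 3\<close>, and \<open>of_nat i\<close> is the \<open>i\<close>-th one
  for \<open>i = 1, 2, 3\<close>.
\<close>

definition conj_space :: "nat \<Rightarrow> nat \<Rightarrow> (complex^3) set" where
  "conj_space r1 r2 = {v. (\<forall>i\<in>{1..r1}. v $ of_nat i \<in> \<real>) \<and>
     (\<forall>k<r2. v $ of_nat (r1 + 2 * k + 2) = cnj (v $ of_nat (r1 + 2 * k + 1)))}"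

definition conj_space_pos :: "nat \<Rightarrow> nat \<Rightarrow> (complex^3) set" where
  "conj_space_pos r1 r2 = {v \<in> conj_space r1 r2. \<forall>i\<in>{1..r1}. 0 < Re (v $ of_nat i)}"

definition embedding_vector :: "int poly \<Rightarrow> nat \<Rightarrow> nat \<Rightarrow> complex^3 \<Rightarrow> bool" where
  "embedding_vector F r1 r2 \<alpha> \<longleftrightarrow> r1 + 2 * r2 = 3 \<and> \<alpha> \<in> conj_space r1 r2 \<and>
     bij_betw (\<lambda>j. \<alpha> $ j) UNIV {z. poly (map_poly of_int F) z = 0}"

definition order_ring :: "complex^3 \<Rightarrow> (complex^3) set" where
  "order_ring \<alpha> = range (\<lambda>p :: int poly. \<chi> j. poly (map_poly of_int p) (\<alpha> $ j))"

definition number_field :: "complex^3 \<Rightarrow> (complex^3) set" where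
  "number_field \<alpha> = range (\<lambda>p :: rat poly. \<chi> j. poly (map_poly of_rat p) (\<alpha> $ j))"

definition power_basis :: "complex^3 \<Rightarrow> 3 \<Rightarrow> complex^3" where
  "power_basis \<alpha> k = (if k = 1 then \<alpha>^2 else if k = 2 then \<alpha> else 1)"


section \<open>Ideals and narrow classes\<close>

definition fractional_ideal :: "complex^3 \<Rightarrow> (complex^3) set \<Rightarrow> bool" where
  "fractional_ideal \<alpha> I \<longleftrightarrow> I \<subseteq> number_field \<alpha> \<and> 0 \<in> I \<and> I \<noteq> {0} \<and>
     (\<forall>x\<in>I. \<forall>y\<in>I. x - y \<in> I) \<and> (\<forall>r\<in>order_ring \<alpha>. \<forall>x\<in>I. r * x \<in> I) \<and>
     (\<exists>d\<in>order_ring \<alpha>. d \<noteq> 0 \<and> (\<forall>x\<in>I. d * x \<in> order_ring \<alpha>))"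

definition ideal_inverse :: "complex^3 \<Rightarrow> (complex^3) set \<Rightarrow> (complex^3) set" where
  "ideal_inverse \<alpha> I = {x \<in> number_field \<alpha>. \<forall>y\<in>I. x * y \<in> order_ring \<alpha>}"

definition ideal_mult :: "(complex^3) set \<Rightarrow> (complex^3) set \<Rightarrow> (complex^3) set" where
  "ideal_mult I J = group_closure {x * y | x y. x \<in> I \<and> y \<in> J}"

definition invertible_ideals :: "complex^3 \<Rightarrow> (complex^3) set set" where
  "invertible_ideals \<alpha> =
     {I. fractional_ideal \<alpha> I \<and> ideal_mult I (ideal_inverse \<alpha> I) = order_ring \<alpha>}"

definition narrow_rel ::
    "nat \<Rightarrow> nat \<Rightarrow> complex^3 \<Rightarrow> ((complex^3) set \<times> (complex^3) set) set" where
  "narrow_rel r1 r2 \<alpha> = {(I, J). I \<in> invertible_ideals \<alpha> \<and> J \<in> invertible_ideals \<alpha> \<and>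
     (\<exists>\<xi> \<in> number_field \<alpha> \<inter> conj_space_pos r1 r2. J = (\<lambda>x. \<xi> * x) ` I)}"

definition narrow_classes :: "nat \<Rightarrow> nat \<Rightarrow> complex^3 \<Rightarrow> (complex^3) set set set" where
  "narrow_classes r1 r2 \<alpha> = invertible_ideals \<alpha> // narrow_rel r1 r2 \<alpha>"

definition narrow_class_number :: "nat \<Rightarrow> nat \<Rightarrow> complex^3 \<Rightarrow> nat" where
  "narrow_class_number r1 r2 \<alpha> = card (narrow_classes r1 r2 \<alpha>)"

text \<open>
  The bijection also forces the set of narrow classes to be finite, since otherwise \<open>card\<close> is 0.
\<close>

definition narrow_class_reps ::
    "nat \<Rightarrow> nat \<Rightarrow> complex^3 \<Rightarrow> (nat \<Rightarrow> (complex^3) set) \<Rightarrow> bool" where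
  "narrow_class_reps r1 r2 \<alpha> I \<longleftrightarrow>
     (\<forall>l \<in> {1..narrow_class_number r1 r2 \<alpha>}. I l \<in> invertible_ideals \<alpha> \<and> I l \<subseteq> order_ring \<alpha>) \<and>
     bij_betw (\<lambda>l. narrow_rel r1 r2 \<alpha> `` {I l})
       {1..narrow_class_number r1 r2 \<alpha>} (narrow_classes r1 r2 \<alpha>)"

definition pos_units :: "nat \<Rightarrow> nat \<Rightarrow> complex^3 \<Rightarrow> (complex^3) set" where
  "pos_units r1 r2 \<alpha> =
     {u \<in> order_ring \<alpha> \<inter> conj_space_pos r1 r2. \<exists>v \<in> order_ring \<alpha>. u * v = 1}"

definition unit_fundamental_domain ::
    "nat \<Rightarrow> nat \<Rightarrow> complex^3 \<Rightarrow> (complex^3) set \<Rightarrow> bool" where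
  "unit_fundamental_domain r1 r2 \<alpha> Dom \<longleftrightarrow>
     Dom \<subseteq> conj_space_pos r1 r2 \<inter> number_field \<alpha> \<and>
     (\<forall>x \<in> conj_space_pos r1 r2 \<inter> number_field \<alpha>.
        \<exists>!y. y \<in> Dom \<and> (\<exists>u \<in> pos_units r1 r2 \<alpha>. y = u * x))"


section \<open>Integral bases and matrices\<close>

definition lincomb :: "(3 \<Rightarrow> complex^3) \<Rightarrow> int^3 \<Rightarrow> complex^3" where
  "lincomb b c = (\<Sum>i\<in>UNIV. of_int (c $ i) * b i)"

definition int_basis :: "(3 \<Rightarrow> complex^3) \<Rightarrow> (complex^3) set \<Rightarrow> bool" where
  "int_basis b M \<longleftrightarrow> bij_betw (lincomb b) UNIV M"

definition embedding_matrix :: "(3 \<Rightarrow> complex^3) \<Rightarrow> complex^3^3" where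
  "embedding_matrix b = (\<chi> i j. b i $ j)"

definition matcomb :: "(3 \<Rightarrow> int^3^3) \<Rightarrow> int^3 \<Rightarrow> int^3^3" where
  "matcomb B c = (\<chi> j k. \<Sum>i\<in>UNIV. c $ i * B i $ j $ k)"

definition cmat :: "int^3^3 \<Rightarrow> complex^3^3" where
  "cmat A = (\<chi> i j. of_int (A $ i $ j))"

definition diag_mat :: "complex^3 \<Rightarrow> complex^3^3" where
  "diag_mat v = (\<chi> i j. if i = j then v $ i else 0)"

definition root_mat :: "int \<Rightarrow> int \<Rightarrow> int \<Rightarrow> int \<Rightarrow> int \<Rightarrow> int \<Rightarrow> int^3^3" where
  "root_mat a1 m1 m2 \<mu>1 \<mu>2 s =
     vector [vector [1, \<mu>1 + a1, s],
             vector [0, m1, - \<mu>2 * m1],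
             vector [0, 0, m1 * m2]]"


section \<open>Cosets and Pluecker coordinates\<close>

definition SL3 :: "(int^3^3) set" where
  "SL3 = {\<gamma>. det \<gamma> = 1}"

definition Gamma_inf :: "(int^3^3) set" where
  "Gamma_inf = {u \<in> SL3. (\<forall>i. u $ i $ i = 1) \<and> u $ 2 $ 1 = 0 \<and> u $ 3 $ 1 = 0 \<and> u $ 3 $ 2 = 0}"

definition coset_space :: "(int^3^3) set set" where
  "coset_space = (\<lambda>\<gamma>. (\<lambda>u. u ** \<gamma>) ` Gamma_inf) ` SL3"

text \<open>
  The set of all \<open>\<gamma>\<close> with first column of the inverse \<open>v\<close> and bottom row \<open>w\<close>. If \<open>v\<close> and \<open>w\<close> are
  primitive and orthogonal, this is a single element of \<open>coset_space\<close>, namely the coset with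
  Pluecker coordinates \<open>v, w\<close>.
\<close>

definition pluecker_coset :: "int^3 \<Rightarrow> int^3 \<Rightarrow> (int^3^3) set" where
  "pluecker_coset v w = {\<gamma> \<in> SL3. column 1 (matrix_inv \<gamma>) = v \<and> row 3 \<gamma> = w}"

definition primitive :: "int^3 \<Rightarrow> bool" where
  "primitive v \<longleftrightarrow> gcd (gcd (v $ 1) (v $ 2)) (v $ 3) = 1"

text \<open>
  In the next two definitions \<open>b\<close> is a basis of \<open>I\<^sub>l\<close>, \<open>bb\<close> a basis of its inverse, and \<open>B\<close>, \<open>B'\<close> are
  the multiplication matrices attached to them; \<open>c\<close>, \<open>c'\<close> are the coordinates of \<open>\<xi>\<close>, \<open>\<xi>'\<close>.
\<close>

definition admissible ::
    "(complex^3) set \<Rightarrow> (3 \<Rightarrow> complex^3) \<Rightarrow> (3 \<Rightarrow> complex^3) \<Rightarrow> (3 \<Rightarrow> int^3^3) \<Rightarrow>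
     (3 \<Rightarrow> int^3^3) \<Rightarrow> int^3 \<Rightarrow> int^3 \<Rightarrow> bool" where
  "admissible Dom b bb B B' c c' \<longleftrightarrow>
     primitive (column 1 (matcomb B c)) \<and> primitive (row 3 (matcomb B' c')) \<and>
     lincomb bb c * lincomb b c' \<in> \<int> \<and> lincomb b c' \<in> Dom"

text \<open>
  Multiplying \<open>\<gamma>\<close> on the left by an element of \<open>Gamma_inf\<close> changes \<open>\<mu>1\<close> and \<open>\<mu>2\<close> only within their
  residue classes modulo \<open>m1\<close> and \<open>m2\<close> (and changes the unspecified entry \<open>s\<close>), so the two matrix
  equations are a condition on the coset and on these residue classes.
\<close>

definition coset_equations ::
    "int \<Rightarrow> (3 \<Rightarrow> complex^3) \<Rightarrow> (3 \<Rightarrow> complex^3) \<Rightarrow> (3 \<Rightarrow> complex^3) \<Rightarrow> (3 \<Rightarrow> int^3^3) \<Rightarrow> int^3 \<Rightarrow>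
     (int^3^3) set \<Rightarrow> int \<Rightarrow> int \<Rightarrow> int \<Rightarrow> int \<Rightarrow> bool" where
  "coset_equations a1 b1 b bb B c K m1 m2 \<mu>1 \<mu>2 \<longleftrightarrow>
     K \<in> coset_space \<and>
     (\<forall>\<gamma>\<in>K. \<exists>\<nu>1 \<nu>2 s. [\<nu>1 = \<mu>1] (mod m1) \<and> [\<nu>2 = \<mu>2] (mod m2) \<and>
        cmat \<gamma> ** embedding_matrix b ** diag_mat (lincomb bb c) =
          cmat (root_mat a1 m1 m2 \<nu>1 \<nu>2 s) ** embedding_matrix b1 \<and>
        root_mat a1 m1 m2 \<nu>1 \<nu>2 s = \<gamma> ** matcomb B c)"

end

theory Submission
  imports Defs "HOL-Computational_Algebra.Field_as_Ring"
begin

text \<open>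
  If \<open>\<gamma>\<close> lies in the coset attached to \<open>c\<close> and \<open>c'\<close>, then the rows of \<open>\<gamma> C\<close> are the coordinates of a
  basis of the ideal \<open>\<xi> I\<^sub>l\<close>. The Pluecker coordinates force \<open>\<gamma> C\<close> to be upper triangular with last row
  \<open>(0, 0, \<xi> \<xi>')\<close>, and stability under multiplication by \<open>\<alpha>\<close> gives its remaining shape and the
  congruences. Conversely, for given \<open>m1, m2, \<mu>1, \<mu>2\<close> the \<open>\<alpha>\<close>-stable lattices of this shape are
  governed by one parameter \<open>t\<close>, which the coprimality of \<open>m1, m2, \<mu>1 - \<mu>2\<close> determines modulo \<open>m2\<close>,
  so that there is exactly one such lattice \<open>L\<close>. It is invertible because \<open>m1 m2\<close> is prime to the
  discriminant. Hence \<open>L = \<xi> I\<^sub>l\<close> with \<open>\<xi>\<close> totally positive for exactly one \<open>l\<close>; \<open>\<xi>\<close> is unique up to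
  totally positive units, and the condition \<open>\<xi>' = m1 m2 / \<xi> \<in> \<D>\<close> removes this ambiguity.
\<close>

text \<open>The equation between complex matrices says no more than the integer equation
  \<open>\<gamma> ** matcomb B c = root_mat ...\<close>: row \<open>j\<close> of
  \<open>matcomb B c\<close> lists the coordinates of \<open>\<xi> * b j\<close> in the power basis,
  so the complex equation is the integer one times the embedding matrix. The correspondence is
  therefore an argument about integer coordinates, and the embeddings then serve to decide signs.
  Signs are the delicate point. The sign convention for the bases and the positivity of norms force
  \<open>m1\<close> to be positive and, in the converse, exclude a change of basis of determinant
  -1. They do not fix the sign of \<open>\<xi> * \<xi>'\<close>: replacing \<open>c\<close> by
  \<open>- c\<close> keeps every assumption and negates \<open>m2\<close>. Hence \<open>m2\<close>
  is positive when the product is a positive integer, and in general only nonzero. The other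
  obstacle is that the order generated by \<alpha> need not be maximal, so a lattice stable under
  \<alpha> need not be invertible; its inverse has to be produced by explicit elements.\<close>

no_notation fps_nth (infixl "$" 75)

section \<open>The cubic order and its field\<close>

lemma of_int_vec_nth [simp]: "(of_int n :: 'a::comm_ring_1^'n) $ j = of_int n"
proof (cases n rule: int_cases2)
  case (nonneg k)
  then show ?thesis by (induction k arbitrary: n) auto
next
  case (nonpos k)
  then show ?thesis by (induction k arbitrary: n) auto
qed

lemma power_vec_nth [simp]: "((x::'a::comm_ring_1^'n) ^ k) $ j = (x $ j) ^ k"
  by (induction k) auto

section \<open>The cubic over the rationals\<close>

lemma cubic_no_rat_root:
  assumes "irreducible (cubic a1 a2 a3)"
  shows "poly (map_poly of_int (cubic a1 a2 a3)) (r::rat) \<noteq> 0"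
proof
  assume r: "poly (map_poly of_int (cubic a1 a2 a3)) r = 0"
  have "algebraic_int r"
    unfolding algebraic_int_altdef_ipoly
    using r by (intro exI[of _ "cubic a1 a2 a3"]) (simp add: cubic_def)
  moreover have "r \<in> \<rat>"
    by (metis Rats_of_rat of_rat_eq_id id_apply)
  ultimately have "r \<in> \<int>"
    by (rule rational_algebraic_int_is_int)
  then obtain k where k: "r = of_int k"
    by (auto elim: Ints_cases)
  have "poly (map_poly of_int (cubic a1 a2 a3)) (of_int k :: rat) = of_int (poly (cubic a1 a2 a3) k)"
    by (simp add: cubic_def map_poly_pCons)
  with r k have "poly (cubic a1 a2 a3) k = 0"
    by simp
  then have "[:-k, 1:] dvd cubic a1 a2 a3"
    by (simp add: poly_eq_0_iff_dvd)
  then obtain q where q: "cubic a1 a2 a3 = [:-k, 1:] * q"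
    by blast
  have deg: "degree (cubic a1 a2 a3) = 3" "cubic a1 a2 a3 \<noteq> 0"
    by (simp_all add: cubic_def)
  have "q \<noteq> 0" using q deg by auto
  with q deg have "degree q = 2"
    using degree_mult_eq[of "[:-k,1:]" q] by auto
  moreover have "[:-k, 1:] dvd 1 \<or> q dvd 1"
    using irreducibleD[OF assms q] .
  ultimately show False
    by (auto simp: is_unit_poly_iff)
qed

text \<open>A proper factorisation of a cubic over a field contains a linear factor, hence a root;
  this takes the place of Gauss's lemma.\<close>

lemma irreducible_cubic_rat:
  assumes "irreducible (cubic a1 a2 a3)"
  shows "irreducible (map_poly of_int (cubic a1 a2 a3) :: rat poly)" (is "irreducible ?F")
proof -
  have deg: "degree ?F = 3" "?F \<noteq> 0"
    by (simp_all add: cubic_def map_poly_pCons)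
  have lin: "degree p \<noteq> 1" if "p dvd ?F" for p
  proof
    assume "degree p = 1"
    then obtain c d where p: "p = [:c, d:]" "d \<noteq> 0"
      by (metis degree1_coeffs)
    have "poly p (- c / d) = 0"
      using p by (simp add: field_simps)
    with that have "poly ?F (- c / d) = 0"
      by (metis dvdE mult_zero_left poly_mult)
    with cubic_no_rat_root[OF assms] show False by blast
  qed
  show ?thesis
  proof (rule irreducibleI)
    show "?F \<noteq> 0" by (rule deg)
    show "\<not> ?F dvd 1"
      using deg by (auto simp: is_unit_iff_degree)
    fix a b assume ab: "?F = a * b"
    then have nz: "a \<noteq> 0" "b \<noteq> 0" using deg by auto
    have "degree a + degree b = 3"
      using ab deg nz by (simp add: degree_mult_eq)
    moreover have "degree a \<noteq> 1" "degree b \<noteq> 1"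
      using lin ab by auto
    ultimately have "degree a = 0 \<or> degree b = 0"
      by linarith
    then show "a dvd 1 \<or> b dvd 1"
      using nz by (simp add: is_unit_iff_degree)
  qed
qed

locale cubic_order =
  fixes a1 a2 a3 :: int and r1 r2 :: nat and \<alpha> :: "complex^3"
  assumes irred: "irreducible (cubic a1 a2 a3)"
    and emb: "embedding_vector (cubic a1 a2 a3) r1 r2 \<alpha>"
begin

abbreviation pb :: "3 \<Rightarrow> complex^3" where "pb \<equiv> power_basis \<alpha>"
abbreviation R :: "(complex^3) set" where "R \<equiv> order_ring \<alpha>"
abbreviation K :: "(complex^3) set" where "K \<equiv> number_field \<alpha>"

lemma alpha_eq_iff: "\<alpha> $ i = \<alpha> $ j \<longleftrightarrow> i = j"
  using emb by (auto simp: embedding_vector_def bij_betw_def inj_on_def)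

lemma alpha_root: "poly (map_poly of_int (cubic a1 a2 a3)) (\<alpha> $ j) = 0"
  using emb by (auto simp: embedding_vector_def bij_betw_def)

lemma alpha_root_nth:
  "(\<alpha> $ j) ^ 3 = - (of_int a1 * (\<alpha> $ j)\<^sup>2) - of_int a2 * \<alpha> $ j - of_int a3"
proof -
  have "of_int a3 + \<alpha> $ j * (of_int a2 + \<alpha> $ j * (of_int a1 + \<alpha> $ j)) = 0"
    using alpha_root[of j] by (simp add: cubic_def map_poly_pCons)
  then show ?thesis by algebra
qed

lemma alpha_cube: "\<alpha> ^ 3 = - (of_int a1 * \<alpha>\<^sup>2) - of_int a2 * \<alpha> - of_int a3"
  by (simp add: vec_eq_iff alpha_root_nth)

lemma r_cases: "r1 = 3 \<and> r2 = 0 \<or> r1 = 1 \<and> r2 = 1"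
proof -
  have "r1 + 2 * r2 = 3" using emb by (simp add: embedding_vector_def)
  then show ?thesis by presburger
qed

section \<open>Field elements as values of rational polynomials\<close>

definition ev :: "rat poly \<Rightarrow> complex^3" where
  "ev p = (\<chi> j. poly (map_poly of_rat p) (\<alpha> $ j))"

lemma ev_nth [simp]: "ev p $ j = poly (map_poly of_rat p) (\<alpha> $ j)"
  by (simp add: ev_def)

lemma number_field_ev: "K = range ev"
  by (simp add: number_field_def ev_def[abs_def])

lemma ev_pCons: "ev (pCons a p) = (\<chi> j. of_rat a) + \<alpha> * ev p"
  by (simp add: vec_eq_iff map_poly_pCons)

lemma ev_add: "ev (p + q) = ev p + ev q"
  by (induction p q rule: poly_induct2) (simp_all add: ev_pCons vec_eq_iff of_rat_add algebra_simps)

lemma ev_0: "ev 0 = 0"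
  by (simp add: vec_eq_iff)

lemma ev_1: "ev 1 = 1"
  by (simp add: vec_eq_iff)

lemma ev_smult: "ev (smult c p) = (\<chi> j. of_rat c) * ev p"
  by (induction p) (simp_all add: ev_0 ev_pCons vec_eq_iff of_rat_mult algebra_simps)

lemma ev_mult: "ev (p * q) = ev p * ev q"
  by (induction p) (simp_all add: ev_0 ev_add ev_smult ev_pCons vec_eq_iff algebra_simps)


section \<open>Integer coordinates in the power basis\<close>

definition el :: "int \<Rightarrow> int \<Rightarrow> int \<Rightarrow> complex^3" where
  "el x y z = of_int x * \<alpha>\<^sup>2 + of_int y * \<alpha> + of_int z"

lemma el_nth: "el x y z $ j = of_int x * (\<alpha> $ j)\<^sup>2 + of_int y * \<alpha> $ j + of_int z"
  by (simp add: el_def)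

lemma el_add: "el x y z + el x' y' z' = el (x + x') (y + y') (z + z')"
  and el_diff: "el x y z - el x' y' z' = el (x - x') (y - y') (z - z')"
  and el_scale: "of_int n * el x y z = el (n * x) (n * y) (n * z)"
  and el_of_int: "of_int n = el 0 0 n"
  by (simp_all add: el_def algebra_simps)

lemma alpha_el: "\<alpha> * el x y z = el (y - a1 * x) (z - a2 * x) (- a3 * x)"
proof -
  have "\<alpha> * el x y z = of_int x * \<alpha> ^ 3 + of_int y * \<alpha>\<^sup>2 + of_int z * \<alpha>"
    by (simp add: el_def algebra_simps power2_eq_square power3_eq_cube)
  also have "\<dots> = el (y - a1 * x) (z - a2 * x) (- a3 * x)"
    unfolding alpha_cube by (simp add: el_def algebra_simps)
  finally show ?thesis .
qed

text \<open>A polynomial of degree at most 2 that vanishes at the three distinct embeddings of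
  \<alpha> is zero.\<close>

lemma el_eq_0: "el x y z = 0 \<longleftrightarrow> x = 0 \<and> y = 0 \<and> z = 0"
proof
  assume "el x y z = 0"
  then have e: "of_int x * (\<alpha> $ j)\<^sup>2 + of_int y * \<alpha> $ j + of_int z = (0::complex)" for j
    by (metis el_nth zero_index)
  let ?p = "[:of_int z, of_int y, of_int x:] :: complex poly"
  have "?p = 0"
  proof (rule ccontr)
    assume nz: "?p \<noteq> 0"
    have "range (\<lambda>j. \<alpha> $ j) \<subseteq> {w. poly ?p w = 0}"
      using e by (auto simp: algebra_simps power2_eq_square)
    then have "card (range (\<lambda>j. \<alpha> $ j)) \<le> card {w. poly ?p w = 0}"
      using nz by (intro card_mono poly_roots_finite)
    also have "\<dots> \<le> degree ?p"
      by (rule card_poly_roots_bound[OF nz])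
    also have "\<dots> \<le> 2" by simp
    finally have "card (range (\<lambda>j. \<alpha> $ j)) \<le> 2" .
    moreover have "card (range (\<lambda>j. \<alpha> $ j)) = 3"
      by (subst card_image) (auto simp: inj_on_def alpha_eq_iff)
    ultimately show False by simp
  qed
  then show "x = 0 \<and> y = 0 \<and> z = 0" by simp
qed (simp add: el_def)

lemma el_eq_iff: "el x y z = el x' y' z' \<longleftrightarrow> x = x' \<and> y = y' \<and> z = z'"
  using el_eq_0[of "x - x'" "y - y'" "z - z'"] by (simp flip: el_diff)

lemma lincomb_pb: "lincomb pb c = el (c $ 1) (c $ 2) (c $ 3)"
  by (simp add: lincomb_def sum_3 el_def power_basis_def)

lemma R_iff: "x \<in> R \<longleftrightarrow> (\<exists>a b c. x = el a b c)"
proof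
  assume "x \<in> R"
  then obtain p where p: "x = (\<chi> j. poly (map_poly of_int p) (\<alpha> $ j))"
    by (auto simp: order_ring_def)
  have "\<exists>a b c. (\<chi> j. poly (map_poly of_int p) (\<alpha> $ j)) = el a b c"
  proof (induction p)
    case 0
    show ?case by (rule exI[of _ 0], rule exI[of _ 0], rule exI[of _ 0]) (simp add: el_def vec_eq_iff)
  next
    case (pCons n p)
    then obtain a b c where "(\<chi> j. poly (map_poly of_int p) (\<alpha> $ j)) = el a b c" by blast
    moreover have "(\<chi> j. poly (map_poly of_int (pCons n p)) (\<alpha> $ j)) =
        of_int n + \<alpha> * (\<chi> j. poly (map_poly of_int p) (\<alpha> $ j))"
      by (simp add: vec_eq_iff map_poly_pCons)
    ultimately show ?case
      by (auto simp: alpha_el el_of_int el_add)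
  qed
  with p show "\<exists>a b c. x = el a b c" by simp
next
  assume "\<exists>a b c. x = el a b c"
  then obtain a b c where x: "x = el a b c" by blast
  have "x = (\<chi> j. poly (map_poly of_int [:c, b, a:]) (\<alpha> $ j))"
    by (simp add: x vec_eq_iff map_poly_pCons el_def algebra_simps power2_eq_square)
  then show "x \<in> R" unfolding order_ring_def by blast
qed

lemma R_el [simp]: "el a b c \<in> R"
  using R_iff by blast

lemma R_add: "x \<in> R \<Longrightarrow> y \<in> R \<Longrightarrow> x + y \<in> R"
  and R_diff: "x \<in> R \<Longrightarrow> y \<in> R \<Longrightarrow> x - y \<in> R"
  by (metis R_iff el_add, metis R_iff el_diff)

lemma R_of_int [simp]: "of_int n \<in> R"
  by (simp add: el_of_int)

lemma R_0 [simp]: "0 \<in> R" and R_1 [simp]: "1 \<in> R"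
  using R_of_int[of 0] R_of_int[of 1] by simp_all

lemma R_alpha_mult: "x \<in> R \<Longrightarrow> \<alpha> * x \<in> R"
  by (metis R_iff alpha_el)

lemma R_int_mult: "x \<in> R \<Longrightarrow> of_int n * x \<in> R"
  by (metis R_iff el_scale)

lemma el_mult: "el a b c * x = of_int a * (\<alpha> * (\<alpha> * x)) + of_int b * (\<alpha> * x) + of_int c * x"
  by (simp add: el_def algebra_simps power2_eq_square)

lemma R_mult: "x \<in> R \<Longrightarrow> y \<in> R \<Longrightarrow> x * y \<in> R"
  by (subst (asm) R_iff) (auto simp: el_mult intro!: R_add R_int_mult R_alpha_mult)

lemma R_alpha [simp]: "\<alpha> \<in> R"
  using R_alpha_mult[OF R_1] by simp

lemma inj_lincomb_pb: "lincomb pb c = lincomb pb c' \<Longrightarrow> c = c'"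
  unfolding lincomb_pb el_eq_iff by (simp add: vec_eq_iff forall_3)

lemma R_subset_K: "R \<subseteq> K"
proof
  fix x assume "x \<in> R"
  then obtain a b c where x: "x = el a b c" by (auto simp: R_iff)
  have "x = ev [:of_int c, of_int b, of_int a:]"
    by (simp add: x ev_pCons ev_0 vec_eq_iff el_def algebra_simps power2_eq_square)
  then show "x \<in> K" unfolding number_field_ev by blast
qed

lemma K_mult: "x \<in> K \<Longrightarrow> y \<in> K \<Longrightarrow> x * y \<in> K"
  by (auto simp: number_field_ev simp flip: ev_mult)

text \<open>\<open>F\<close> is irreducible over the rationals and does not divide \<open>p\<close>,
  so a Bezout relation between them, evaluated at \<alpha>, inverts \<open>ev p\<close>.\<close>

lemma K_inverse:
  assumes "x \<in> K" "x \<noteq> 0"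
  obtains y where "y \<in> K" "x * y = 1"
proof -
  obtain p where p: "x = ev p" using assms by (auto simp: number_field_ev)
  let ?F = "map_poly of_int (cubic a1 a2 a3) :: rat poly"
  have F0: "ev ?F = 0"
    using alpha_root
    by (simp add: vec_eq_iff cubic_def map_poly_pCons)
  have "\<not> ?F dvd p"
  proof
    assume "?F dvd p"
    then obtain q where "p = ?F * q" ..
    then have "ev p = 0" by (simp add: ev_mult F0)
    with p assms show False by simp
  qed
  then have "coprime ?F p"
    using irreducible_cubic_rat[OF irred] 
    by (intro prime_elem_imp_coprime) (auto simp: irreducible_imp_prime_elem)
  then have "gcd ?F p = 1" by (simp add: coprime_iff_gcd_eq_1)
  then obtain s t where "s * ?F + t * p = 1"
    by (metis bezout_coefficients_fst_snd)
  then have "ev (s * ?F + t * p) = 1" by (simp add: ev_1)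
  then have "x * ev t = 1" by (simp add: ev_add ev_mult F0 p mult.commute)
  then show ?thesis using that by (auto simp: number_field_ev)
qed

text \<open>The ambient ring \<open>complex^3\<close> has zero divisors; cancellation is available
  only because nonzero elements of \<open>K\<close> are invertible.\<close>

lemma K_nth_nonzero: "x \<in> K \<Longrightarrow> x \<noteq> 0 \<Longrightarrow> x $ j \<noteq> 0"
  by (metis K_inverse mult_zero_left one_index vector_mult_component zero_neq_one)

lemma K_mult_eq_0: "x \<in> K \<Longrightarrow> x * y = 0 \<longleftrightarrow> x = 0 \<or> y = 0"
  by (auto simp: vec_eq_iff dest: K_nth_nonzero)

lemma K_mult_cancel: "x \<in> K \<Longrightarrow> x \<noteq> 0 \<Longrightarrow> x * y = x * z \<Longrightarrow> y = z"
  using K_mult_eq_0[of x "y - z"] by (simp add: algebra_simps)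

end

section \<open>Integer matrices and Pluecker cosets\<close>

lemma lincomb_3: "lincomb b c = of_int (c $ 1) * b 1 + of_int (c $ 2) * b 2 + of_int (c $ 3) * b 3"
  by (simp add: lincomb_def sum_3)

lemma lincomb_add: "lincomb b (c + d) = lincomb b c + lincomb b d"
  and lincomb_diff: "lincomb b (c - d) = lincomb b c - lincomb b d"
  by (simp_all add: lincomb_3 algebra_simps)

lemma lincomb_mult_left: "lincomb (\<lambda>j. \<xi> * b j) c = \<xi> * lincomb b c"
  by (simp add: lincomb_3 algebra_simps)

lemma lincomb_axis: "lincomb b (axis i 1) = b i"
proof -
  have "lincomb b (axis i 1) = (\<Sum>j\<in>UNIV. if j = i then b j else 0)"
    unfolding lincomb_def by (intro sum.cong) (auto simp: axis_def)
  then show ?thesis by simp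
qed

section \<open>Change of basis by integer matrices\<close>

definition xform :: "int^3^3 \<Rightarrow> (3 \<Rightarrow> complex^3) \<Rightarrow> 3 \<Rightarrow> complex^3" where
  "xform A b = (\<lambda>i. lincomb b (A $ i))"

lemma lincomb_xform: "lincomb (xform A b) c = lincomb b (c v* A)"
  by (simp add: lincomb_3 xform_def vector_matrix_mult_def sum_3 algebra_simps)

lemma row_matrix_mult: "(A ** B) $ i = (A $ i) v* B"
  for A B :: "'a::comm_semiring_1^3^3"
  by (simp add: matrix_matrix_mult_def vector_matrix_mult_def vec_eq_iff mult.commute)

lemma xform_mult: "xform A (xform B b) = xform (A ** B) b"
  by (rule ext) (simp add: xform_def[of A] xform_def[of "A ** B"] lincomb_xform row_matrix_mult)

lemma xform_1: "xform (mat 1) b = b"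
proof
  fix i
  have "(mat 1 :: int^3^3) $ i = axis i 1"
    by (auto simp: mat_def axis_def vec_eq_iff)
  then show "xform (mat 1) b i = b i"
    by (simp add: xform_def lincomb_axis)
qed

lemma range_lincomb_xform_subset: "range (lincomb (xform A b)) \<subseteq> range (lincomb b)"
  by (auto simp: lincomb_xform)

lemma range_lincomb_xform:
  assumes "A' ** A = mat 1"
  shows "range (lincomb (xform A b)) = range (lincomb b)"
  using range_lincomb_xform_subset[of A b] range_lincomb_xform_subset[of A' "xform A b"]
  by (simp add: xform_mult assms xform_1)

lemma inverse_of_det_1:
  fixes A :: "'a::comm_ring_1^3^3"
  assumes "det A = 1"
  obtains A' where "A ** A' = mat 1" "A' ** A = mat 1" "det A' = 1"
proof -
  \<comment> \<open>The adjugate: both products with \<open>A\<close> are \<open>det A\<close> times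
    the identity, over any commutative ring.\<close>
  define A' :: "'a^3^3" where "A' = vector [
    vector [A$2$2 * A$3$3 - A$2$3 * A$3$2, A$1$3 * A$3$2 - A$1$2 * A$3$3, A$1$2 * A$2$3 - A$1$3 * A$2$2],
    vector [A$2$3 * A$3$1 - A$2$1 * A$3$3, A$1$1 * A$3$3 - A$1$3 * A$3$1, A$1$3 * A$2$1 - A$1$1 * A$2$3],
    vector [A$2$1 * A$3$2 - A$2$2 * A$3$1, A$1$2 * A$3$1 - A$1$1 * A$3$2, A$1$1 * A$2$2 - A$1$2 * A$2$1]]"
  have "A ** A' = mat 1"
    unfolding assms[symmetric]
    by (simp add: vec_eq_iff forall_3 matrix_matrix_mult_def sum_3 mat_def A'_def det_3)
       (simp add: algebra_simps)
  moreover have "A' ** A = mat 1"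
    unfolding assms[symmetric]
    by (simp add: vec_eq_iff forall_3 matrix_matrix_mult_def sum_3 mat_def A'_def det_3)
       (simp add: algebra_simps)
  moreover from this have "det A' * det A = 1"
    by (metis det_mul det_I)
  ultimately show ?thesis using that assms by simp
qed

section \<open>Cosets with prescribed Pluecker coordinates\<close>

lemma column_mult_axis: "A *v axis j 1 = column j A"
  for A :: "'a::comm_semiring_1^'n^'m"
proof -
  have "(\<Sum>k\<in>UNIV. A $ i $ k * axis j 1 $ k) = (\<Sum>k\<in>UNIV. if k = j then A $ i $ k else 0)" for i
    by (intro sum.cong) (auto simp: axis_def)
  then show ?thesis
    by (simp add: matrix_vector_mult_def column_def vec_eq_iff)
qed

text \<open>Applying \<gamma> to the first column of its inverse removes the inverse from the
  definition.\<close>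

lemma pluecker_coset_iff:
  "\<gamma> \<in> pluecker_coset v w \<longleftrightarrow> det \<gamma> = 1 \<and> \<gamma> *v v = axis 1 1 \<and> row 3 \<gamma> = w"
proof (cases "det \<gamma> = 1")
  case True
  obtain A where "\<gamma> ** A = mat 1" "A ** \<gamma> = mat 1"
    using inverse_of_det_1[OF True] by blast
  then have inv: "\<gamma> ** matrix_inv \<gamma> = mat 1 \<and> matrix_inv \<gamma> ** \<gamma> = mat 1"
    unfolding matrix_inv_def by (metis (mono_tags, lifting) someI_ex)
  have col: "column 1 (matrix_inv \<gamma>) = matrix_inv \<gamma> *v axis 1 1"
    by (simp add: column_mult_axis)
  have "matrix_inv \<gamma> *v axis 1 1 = v \<longleftrightarrow> \<gamma> *v v = axis 1 1"
    using inv by (metis matrix_vector_mul_assoc matrix_vector_mul_lid)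
  with True col show ?thesis by (simp add: pluecker_coset_def SL3_def)
qed (simp add: pluecker_coset_def SL3_def)

definition umat :: "int \<Rightarrow> int \<Rightarrow> int \<Rightarrow> int^3^3" where
  "umat p q r = vector [vector [1, p, q], vector [0, 1, r], vector [0, 0, 1]]"

lemma Gamma_inf_iff: "u \<in> Gamma_inf \<longleftrightarrow> (\<exists>p q r. u = umat p q r)"
proof
  assume "u \<in> Gamma_inf"
  then have "u = umat (u$1$2) (u$1$3) (u$2$3)"
    by (auto simp: Gamma_inf_def umat_def vec_eq_iff forall_3)
  then show "\<exists>p q r. u = umat p q r" by blast
qed (auto simp: Gamma_inf_def SL3_def umat_def det_3 forall_3)

text \<open>This is why only the residue classes of \<open>\<mu>1\<close> and \<open>\<mu>2\<close>
  belong to a coset. With \<open>p = r = 0\<close> the entry \<open>q\<close> moves the parameter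
  \<open>t\<close> of the upper right entry by a multiple of \<open>m2\<close>.\<close>

lemma umat_root_mat:
  "umat p q r ** root_mat a1 m1 m2 \<mu>1 \<mu>2 s =
    root_mat a1 m1 m2 (\<mu>1 + p * m1) (\<mu>2 - r * m2) (s - p * \<mu>2 * m1 + q * m1 * m2)"
  by (simp add: umat_def root_mat_def vec_eq_iff forall_3 matrix_matrix_mult_def sum_3 algebra_simps)

lemma primitive_bezout:
  assumes "primitive v"
  obtains x y z where "x * v $ 1 + y * v $ 2 + z * v $ 3 = 1"
proof -
  obtain s t where st: "s * v $ 1 + t * v $ 2 = gcd (v $ 1) (v $ 2)"
    using bezout_int by blast
  obtain p z where "p * gcd (v $ 1) (v $ 2) + z * v $ 3 = 1"
    using assms bezout_int unfolding primitive_def by metis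
  then have "p * (s * v $ 1 + t * v $ 2) + z * v $ 3 = 1" by (simp add: st)
  then have "(p * s) * v $ 1 + (p * t) * v $ 2 + z * v $ 3 = 1" by (simp add: algebra_simps)
  then show ?thesis by (rule that)
qed

lemma primitiveI:
  assumes "x * v $ 1 + y * v $ 2 + z * v $ 3 = 1"
  shows "primitive v"
proof -
  let ?g = "gcd (gcd (v $ 1) (v $ 2)) (v $ 3)"
  have "?g dvd v $ 1" "?g dvd v $ 2" "?g dvd v $ 3"
    by (meson dvd_trans gcd_dvd1 gcd_dvd2)+
  then have "?g dvd x * v $ 1 + y * v $ 2 + z * v $ 3" by simp
  then show ?thesis by (simp add: assms primitive_def)
qed

lemma pluecker_coset_exists:
  assumes "primitive v" "primitive w" "v $ 1 * w $ 1 + v $ 2 * w $ 2 + v $ 3 * w $ 3 = 0"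
  obtains \<gamma> where "\<gamma> \<in> pluecker_coset v w"
proof -
  obtain p q r where pqr: "p * v $ 1 + q * v $ 2 + r * v $ 3 = 1"
    using primitive_bezout[OF assms(1)] .
  obtain x y z where xyz: "x * w $ 1 + y * w $ 2 + z * w $ 3 = 1"
    using primitive_bezout[OF assms(2)] .
  \<comment> \<open>The middle row is the cross product of \<open>(x, y, z)\<close> and \<open>v\<close>; its cross product with \<open>w\<close> is \<open>v\<close>.\<close>
  define \<gamma> :: "int^3^3" where "\<gamma> = vector [vector [p, q, r],
    vector [y * v $ 3 - z * v $ 2, z * v $ 1 - x * v $ 3, x * v $ 2 - y * v $ 1], w]"
  \<comment> \<open>With \<open>e = (x, y, z)\<close>, this is the expansion
    \<open>(e \<times> v) \<times> w = (e . w) v - (v . w) e\<close> paired with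
    \<open>(p, q, r)\<close>.\<close>
  have "det \<gamma> = (p * v $ 1 + q * v $ 2 + r * v $ 3) * (x * w $ 1 + y * w $ 2 + z * w $ 3)
     - (p * x + q * y + r * z) * (v $ 1 * w $ 1 + v $ 2 * w $ 2 + v $ 3 * w $ 3)"
    by (simp add: \<gamma>_def det_3 algebra_simps)
  then have "det \<gamma> = 1" by (simp add: assms(3) pqr xyz)
  moreover have "\<gamma> *v v = axis 1 1"
    using pqr assms(3)
    by (simp add: \<gamma>_def vec_eq_iff forall_3 matrix_vector_mult_def sum_3 axis_def algebra_simps)
  moreover have "row 3 \<gamma> = w"
    by (simp add: \<gamma>_def row_def vec_eq_iff)
  ultimately show ?thesis using that pluecker_coset_iff by blast
qed

lemma row_mult: "row i (A ** B) = row i A v* B"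
  for A B :: "'a::comm_semiring_1^3^3"
  by (simp add: row_def matrix_matrix_mult_def vector_matrix_mult_def vec_eq_iff mult.commute)

text \<open>The quotient of two members has the first column and the last row of the identity;
  determinant 1 then leaves 1 as its middle diagonal entry.\<close>

lemma pluecker_coset_orbit:
  assumes "\<gamma> \<in> pluecker_coset v w"
  shows "pluecker_coset v w = (\<lambda>u. u ** \<gamma>) ` Gamma_inf"
proof (intro subset_antisym subsetI)
  note \<gamma> = assms[unfolded pluecker_coset_iff]
  {
    fix \<gamma>' assume "\<gamma>' \<in> (\<lambda>u. u ** \<gamma>) ` Gamma_inf"
    then obtain p q r where \<gamma>': "\<gamma>' = umat p q r ** \<gamma>"
      by (auto simp: Gamma_inf_iff)
    have "det \<gamma>' = 1"
      unfolding \<gamma>' det_mul using \<gamma> by (simp add: umat_def det_3)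
    moreover have "\<gamma>' *v v = axis 1 1"
      unfolding \<gamma>' matrix_vector_mul_assoc[symmetric] using \<gamma>
      by (simp add: umat_def vec_eq_iff forall_3 matrix_vector_mult_def sum_3 axis_def)
    moreover have "row 3 \<gamma>' = w"
      using \<gamma>
      by (simp add: \<gamma>' umat_def row_def vec_eq_iff matrix_matrix_mult_def sum_3)
    ultimately show "\<gamma>' \<in> pluecker_coset v w"
      by (simp add: pluecker_coset_iff)
  next
    fix \<gamma>' assume "\<gamma>' \<in> pluecker_coset v w"
    then have \<gamma>': "det \<gamma>' = 1" "\<gamma>' *v v = axis 1 1" "row 3 \<gamma>' = w"
      by (simp_all add: pluecker_coset_iff)
    obtain A where A: "\<gamma> ** A = mat 1" "A ** \<gamma> = mat 1" "det A = 1"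
      using \<gamma> inverse_of_det_1 by metis
    define u where "u = \<gamma>' ** A"
    have "u *v axis 1 1 = \<gamma>' *v ((A ** \<gamma>) *v v)"
      using \<gamma> unfolding u_def by (metis matrix_vector_mul_assoc)
    then have "u *v axis 1 1 = axis 1 1"
      by (simp add: A \<gamma>')
    then have col: "u $ 1 $ 1 = 1" "u $ 2 $ 1 = 0" "u $ 3 $ 1 = 0"
      by (simp_all add: vec_eq_iff forall_3 matrix_vector_mult_def sum_3 axis_def)
    have "row 3 u = row 3 (\<gamma> ** A)"
      using \<gamma> \<gamma>' by (simp add: u_def row_mult)
    then have row: "u $ 3 $ 2 = 0" "u $ 3 $ 3 = 1"
      by (simp_all add: A row_def vec_eq_iff forall_3 mat_def)
    have "det u = 1" by (simp add: u_def det_mul A \<gamma>')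
    with col row have "u $ 2 $ 2 = 1" by (simp add: det_3)
    with col row \<open>det u = 1\<close> have "u \<in> Gamma_inf"
      by (simp add: Gamma_inf_def SL3_def forall_3)
    moreover have "\<gamma>' = u ** \<gamma>"
      unfolding u_def by (metis A(2) matrix_mul_assoc matrix_mul_rid)
    ultimately show "\<gamma>' \<in> (\<lambda>u. u ** \<gamma>) ` Gamma_inf" by blast
  }
qed

lemma pluecker_coset_in_coset_space:
  assumes "\<gamma> \<in> pluecker_coset v w"
  shows "pluecker_coset v w \<in> coset_space"
  using pluecker_coset_orbit[OF assms] assms
  by (auto simp: coset_space_def pluecker_coset_def)

section \<open>From integer matrix equations to embeddings\<close>

lemma embedding_matrix_eq:
  assumes "\<And>j. \<xi> * b j = lincomb b1 (C $ j)"
  shows "cmat \<gamma> ** embedding_matrix b ** diag_mat \<xi> = cmat (\<gamma> ** C) ** embedding_matrix b1"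
proof -
  have e: "\<xi> $ k * b j $ k = of_int (C $ j $ 1) * b1 1 $ k + of_int (C $ j $ 2) * b1 2 $ k
      + of_int (C $ j $ 3) * b1 3 $ k" for j k
    using arg_cong[OF assms[of j], of "\<lambda>v. v $ k"] by (simp add: lincomb_3)
  have "(cmat \<gamma> ** embedding_matrix b ** diag_mat \<xi>) $ i $ k =
      (\<Sum>j\<in>UNIV. of_int (\<gamma> $ i $ j) * (\<xi> $ k * b j $ k))" for i k
  proof -
    have "(cmat \<gamma> ** embedding_matrix b ** diag_mat \<xi>) $ i $ k =
        (\<Sum>j\<in>UNIV. (cmat \<gamma> ** embedding_matrix b) $ i $ j * (if j = k then \<xi> $ j else 0))"
      by (simp add: matrix_matrix_mult_def[of "cmat \<gamma> ** embedding_matrix b"] diag_mat_def)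
    also have "\<dots> = (\<Sum>j\<in>UNIV. if j = k then (cmat \<gamma> ** embedding_matrix b) $ i $ j * \<xi> $ j else 0)"
      by (intro sum.cong) auto
    also have "\<dots> = (\<Sum>l\<in>UNIV. of_int (\<gamma> $ i $ l) * b l $ k) * \<xi> $ k"
      by (simp add: matrix_matrix_mult_def cmat_def embedding_matrix_def)
    finally show ?thesis by (simp add: sum_distrib_left sum_distrib_right mult_ac)
  qed
  then show ?thesis
    by (simp add: vec_eq_iff e)
       (simp add: matrix_matrix_mult_def cmat_def embedding_matrix_def sum_3 algebra_simps)
qed

lemma cong_add_mult_right: "[x = y] (mod m) \<Longrightarrow> [x + k * m = y] (mod m)"
  for x y m k :: int
  by (simp add: cong_def)

text \<open>One representative suffices: the others differ by some \<open>umat p q r\<close>, which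
  shifts the roots within their classes, and the complex equation follows from the integer
  one.\<close>

lemma coset_equations_iff:
  assumes "\<And>j. lincomb bb c * b j = lincomb b1 (matcomb B c $ j)"
    and "\<gamma> \<in> pluecker_coset v w"
  shows "coset_equations a1 b1 b bb B c (pluecker_coset v w) m1 m2 \<mu>1 \<mu>2 \<longleftrightarrow>
    (\<exists>\<nu>1 \<nu>2 s. [\<nu>1 = \<mu>1] (mod m1) \<and> [\<nu>2 = \<mu>2] (mod m2) \<and>
       root_mat a1 m1 m2 \<nu>1 \<nu>2 s = \<gamma> ** matcomb B c)" (is "_ \<longleftrightarrow> ?r")
proof
  assume ?r
  then obtain \<nu>1 \<nu>2 s where \<nu>: "[\<nu>1 = \<mu>1] (mod m1)" "[\<nu>2 = \<mu>2] (mod m2)"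
       "root_mat a1 m1 m2 \<nu>1 \<nu>2 s = \<gamma> ** matcomb B c" by blast
  show "coset_equations a1 b1 b bb B c (pluecker_coset v w) m1 m2 \<mu>1 \<mu>2"
    unfolding coset_equations_def
  proof (intro conjI ballI)
    show "pluecker_coset v w \<in> coset_space"
      by (rule pluecker_coset_in_coset_space[OF assms(2)])
    fix \<gamma>' assume "\<gamma>' \<in> pluecker_coset v w"
    then obtain p q r where \<gamma>': "\<gamma>' = umat p q r ** \<gamma>"
      unfolding pluecker_coset_orbit[OF assms(2)] by (auto simp: Gamma_inf_iff)
    have r: "root_mat a1 m1 m2 (\<nu>1 + p * m1) (\<nu>2 - r * m2) (s - p * \<nu>2 * m1 + q * m1 * m2) =
        \<gamma>' ** matcomb B c"
      unfolding umat_root_mat[symmetric] \<gamma>' \<nu> by (simp add: matrix_mul_assoc)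
    moreover have "[\<nu>1 + p * m1 = \<mu>1] (mod m1)" "[\<nu>2 - r * m2 = \<mu>2] (mod m2)"
      using \<nu> cong_add_mult_right[of \<nu>1 \<mu>1 m1 p] cong_add_mult_right[of \<nu>2 \<mu>2 m2 "- r"] by simp_all
    ultimately show "\<exists>\<nu>1 \<nu>2 s. [\<nu>1 = \<mu>1] (mod m1) \<and> [\<nu>2 = \<mu>2] (mod m2) \<and>
        cmat \<gamma>' ** embedding_matrix b ** diag_mat (lincomb bb c) =
          cmat (root_mat a1 m1 m2 \<nu>1 \<nu>2 s) ** embedding_matrix b1 \<and>
        root_mat a1 m1 m2 \<nu>1 \<nu>2 s = \<gamma>' ** matcomb B c"
      using embedding_matrix_eq[OF assms(1), of \<gamma>'] by metis
  qed
next
  assume "coset_equations a1 b1 b bb B c (pluecker_coset v w) m1 m2 \<mu>1 \<mu>2"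
  with assms(2) show ?r unfolding coset_equations_def by blast
qed

section \<open>Lattices stable under \<open>\<alpha>\<close>\<close>

lemma poly_cubic: "poly (cubic a1 a2 a3) \<mu> = \<mu>^3 + a1 * \<mu>\<^sup>2 + a2 * \<mu> + a3"
  by (simp add: cubic_def algebra_simps power2_eq_square power3_eq_cube)

text \<open>On the diagonal \<open>x = y\<close> this is the derivative of \<open>F\<close>, which
  decides invertibility later.\<close>

definition divided_diff :: "int \<Rightarrow> int \<Rightarrow> int \<Rightarrow> int \<Rightarrow> int" where
  "divided_diff a1 a2 x y = x\<^sup>2 + x * y + y\<^sup>2 + a1 * (x + y) + a2"

lemma divided_diff_mult:
  "(x - y) * divided_diff a1 a2 x y = poly (cubic a1 a2 a3) x - poly (cubic a1 a2 a3) y"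
  unfolding poly_cubic divided_diff_def by algebra

text \<open>
  The condition for the lattice spanned by the rows of the root matrix with upper right entry
  \<open>a2 + (\<mu>1 + a1) * \<mu>1 + m1 * t\<close> to be stable under multiplication by \<open>\<alpha>\<close>.
\<close>

definition hnf_cond :: "int \<Rightarrow> int \<Rightarrow> int \<Rightarrow> int \<Rightarrow> int \<Rightarrow> int \<Rightarrow> int \<Rightarrow> int \<Rightarrow> bool" where
  "hnf_cond a1 a2 a3 m1 m2 \<mu>1 \<mu>2 t \<longleftrightarrow>
     m2 dvd divided_diff a1 a2 \<mu>1 \<mu>2 + m1 * t \<and>
     m1 * m2 dvd poly (cubic a1 a2 a3) \<mu>1 + m1 * t * (\<mu>1 - \<mu>2)"

lemma hnf_cond_roots:
  assumes "hnf_cond a1 a2 a3 m1 m2 \<mu>1 \<mu>2 t"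
  shows "[poly (cubic a1 a2 a3) \<mu>1 = 0] (mod m1)" "[poly (cubic a1 a2 a3) \<mu>2 = 0] (mod m2)"
proof -
  let ?f = "poly (cubic a1 a2 a3)"
  obtain k where k: "?f \<mu>1 + m1 * t * (\<mu>1 - \<mu>2) = m1 * m2 * k"
    using assms unfolding hnf_cond_def by (elim conjE dvdE)
  have "?f \<mu>1 = m1 * (m2 * k - t * (\<mu>1 - \<mu>2))"
    using k by algebra
  then show "[?f \<mu>1 = 0] (mod m1)"
    by (simp add: cong_0_iff)
  obtain j where j: "divided_diff a1 a2 \<mu>1 \<mu>2 + m1 * t = m2 * j"
    using assms unfolding hnf_cond_def by (elim conjE dvdE)
  \<comment> \<open>Subtracting \<open>\<mu>1 - \<mu>2\<close> times the first relation from the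
    second cancels \<open>t\<close> and turns \<open>F(\<mu>1)\<close> into
    \<open>F(\<mu>2)\<close>.\<close>
  have "?f \<mu>2 = m2 * (m1 * k - j * (\<mu>1 - \<mu>2))"
    using k j divided_diff_mult[of \<mu>1 \<mu>2 a1 a2 a3] by algebra
  then show "[?f \<mu>2 = 0] (mod m2)"
    by (simp add: cong_0_iff)
qed

text \<open>After division by \<open>m1\<close> there are two linear congruences for
  \<open>t\<close> modulo \<open>m2\<close>, with coefficients \<open>m1\<close> and
  \<open>\<mu>1 - \<mu>2\<close>. They are compatible by the divided difference identity, recorded
  as \<open>mf\<close>.\<close>

lemma hnf_cond_exists:
  assumes "m1 \<noteq> 0" "[poly (cubic a1 a2 a3) \<mu>1 = 0] (mod m1)" "[poly (cubic a1 a2 a3) \<mu>2 = 0] (mod m2)"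
    and "gcd (gcd m1 m2) (\<mu>1 - \<mu>2) = 1"
  shows "\<exists>t. hnf_cond a1 a2 a3 m1 m2 \<mu>1 \<mu>2 t"
proof -
  let ?f = "poly (cubic a1 a2 a3)" and ?q = "divided_diff a1 a2 \<mu>1 \<mu>2" and ?\<delta> = "\<mu>1 - \<mu>2"
  obtain f where f: "?f \<mu>1 = m1 * f" using assms(2) by (auto simp: cong_0_iff)
  obtain g where g: "?f \<mu>2 = m2 * g" using assms(3) by (auto simp: cong_0_iff)
  have "primitive (vector [m1, m2, ?\<delta>])" using assms(4) by (simp add: primitive_def)
  then obtain u w v where uvw: "u * m1 + w * m2 + v * ?\<delta> = 1"
    by (rule primitive_bezout) simp
  \<comment> \<open>Forced by \<open>t = u * (m1 * t) + v * (?\<delta> * t)\<close> modulo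
    \<open>m2\<close>, where \<open>m1 * t\<close> must be \<open>- ?q\<close> and
    \<open>?\<delta> * t\<close> must be \<open>- f\<close>.\<close>
  define t where "t = - (u * ?q + v * f)"
  have mf: "m1 * f = ?\<delta> * ?q + m2 * g"
    using divided_diff_mult[of \<mu>1 \<mu>2 a1 a2 a3] f g by algebra
  have "?q + m1 * t = m2 * (w * ?q - v * g)"
    unfolding t_def using mf uvw by algebra
  moreover have "f + t * ?\<delta> = m2 * (u * g + w * f)"
    unfolding t_def using mf uvw by algebra
  then have "?f \<mu>1 + m1 * t * ?\<delta> = m1 * m2 * (u * g + w * f)"
    unfolding f by algebra
  ultimately show ?thesis unfolding hnf_cond_def by (metis dvd_triv_left)
qed

text \<open>Both \<open>m1\<close> and \<open>\<mu>1 - \<mu>2\<close> annihilate the difference of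
  two solutions modulo \<open>m2\<close>, hence so does their combination that is 1 modulo
  \<open>m2\<close>.\<close>

lemma hnf_cond_unique:
  assumes "m1 \<noteq> 0" "gcd (gcd m1 m2) (\<mu>1 - \<mu>2) = 1"
    and "hnf_cond a1 a2 a3 m1 m2 \<mu>1 \<mu>2 t" "hnf_cond a1 a2 a3 m1 m2 \<mu>1 \<mu>2 t'"
  shows "m2 dvd t' - t"
proof -
  let ?\<delta> = "\<mu>1 - \<mu>2"
  have "m2 dvd (divided_diff a1 a2 \<mu>1 \<mu>2 + m1 * t') - (divided_diff a1 a2 \<mu>1 \<mu>2 + m1 * t)"
    using assms unfolding hnf_cond_def by (meson dvd_diff)
  then have 1: "m2 dvd m1 * (t' - t)" by (simp add: algebra_simps)
  have "m1 * m2 dvd (poly (cubic a1 a2 a3) \<mu>1 + m1 * t' * ?\<delta>) - (poly (cubic a1 a2 a3) \<mu>1 + m1 * t * ?\<delta>)"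
    using assms unfolding hnf_cond_def by (meson dvd_diff)
  then have "m1 * m2 dvd m1 * (?\<delta> * (t' - t))" by (simp add: algebra_simps)
  then have 2: "m2 dvd ?\<delta> * (t' - t)" using assms(1) by simp
  have "primitive (vector [m1, m2, ?\<delta>])" using assms(2) by (simp add: primitive_def)
  then obtain u w v where uvw: "u * m1 + w * m2 + v * ?\<delta> = 1"
    by (rule primitive_bezout) simp
  have "m2 dvd u * (m1 * (t' - t)) + m2 * (w * (t' - t)) + v * (?\<delta> * (t' - t))"
    by (intro dvd_add[OF dvd_add[OF dvd_mult[OF 1] dvd_triv_left] dvd_mult[OF 2]])
  also have "\<dots> = (u * m1 + w * m2 + v * ?\<delta>) * (t' - t)" by algebra
  finally show ?thesis by (simp add: uvw)
qed

section \<open>Simple roots modulo divisors prime to the discriminant\<close>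

lemma disc_bezout:
  "\<exists>x y. cubic_disc a1 a2 a3 = x * divided_diff a1 a2 \<mu> \<mu> + y * poly (cubic a1 a2 a3) \<mu>"
proof -
  \<comment> \<open>The discriminant is invariant under the substitution \<open>X \<mapsto> X + \<mu>\<close>; afterwards the last two
    coefficients are \<open>F'(\<mu>)\<close> and \<open>F(\<mu>)\<close>, and every term of the discriminant contains one of them.\<close>
  define e1 e2 e3 where "e1 = 3 * \<mu> + a1" and "e2 = divided_diff a1 a2 \<mu> \<mu>"
    and "e3 = poly (cubic a1 a2 a3) \<mu>"
  have "cubic_disc a1 a2 a3 =
      (e1\<^sup>2 * e2 - 4 * e2\<^sup>2 + 18 * e1 * e3) * e2 + (- 4 * e1 ^ 3 - 27 * e3) * e3"
    unfolding cubic_disc_def e1_def e2_def e3_def divided_diff_def poly_cubic by algebra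
  then show ?thesis unfolding e2_def e3_def by blast
qed

lemma simple_root_mod:
  assumes "coprime m (cubic_disc a1 a2 a3)" "m dvd poly (cubic a1 a2 a3) \<mu>"
  obtains e k where "e * divided_diff a1 a2 \<mu> \<mu> + k * m = 1"
proof -
  obtain x y where xy:
    "cubic_disc a1 a2 a3 = x * divided_diff a1 a2 \<mu> \<mu> + y * poly (cubic a1 a2 a3) \<mu>"
    using disc_bezout by blast
  obtain p q where "p * m + q * cubic_disc a1 a2 a3 = 1"
    using assms(1) bezout_int[of m "cubic_disc a1 a2 a3"] by auto
  moreover obtain g where "poly (cubic a1 a2 a3) \<mu> = m * g" using assms(2) ..
  ultimately have "(q * x) * divided_diff a1 a2 \<mu> \<mu> + (p + q * y * g) * m = 1"
    using xy by algebra
  then show ?thesis by (rule that)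
qed

section \<open>Lattices with an upper triangular basis\<close>

context cubic_order
begin

definition lat :: "int^3^3 \<Rightarrow> (complex^3) set" where
  "lat A = range (lincomb (xform A pb))"

text \<open>Stability fixes the upper right entry modulo \<open>m1\<close>; \<open>t\<close> is the
  coefficient of the second row in \<alpha> times the first.\<close>

definition hnf :: "int \<Rightarrow> int \<Rightarrow> int \<Rightarrow> int \<Rightarrow> int \<Rightarrow> (complex^3) set" where
  "hnf m1 m2 \<mu>1 \<mu>2 t = lat (root_mat a1 m1 m2 \<mu>1 \<mu>2 (a2 + (\<mu>1 + a1) * \<mu>1 + m1 * t))"

lemma lat_mult:
  assumes "det \<gamma> = 1"
  shows "lat (\<gamma> ** A) = lat A"
proof -
  obtain \<gamma>' where "\<gamma>' ** \<gamma> = mat 1" using inverse_of_det_1[OF assms] by metis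
  then show ?thesis
    unfolding lat_def xform_mult[symmetric] by (rule range_lincomb_xform)
qed

lemma lat_diff: "z \<in> lat A \<Longrightarrow> z' \<in> lat A \<Longrightarrow> z - z' \<in> lat A"
  by (auto simp: lat_def simp flip: lincomb_diff)

lemma lat_add: "z \<in> lat A \<Longrightarrow> z' \<in> lat A \<Longrightarrow> z + z' \<in> lat A"
  by (auto simp: lat_def simp flip: lincomb_add)

lemma lat_row: "lincomb pb (A $ i) \<in> lat A"
  unfolding lat_def by (metis lincomb_axis rangeI xform_def)

lemma lat_0: "0 \<in> lat A"
  using lat_diff[OF lat_row[of A 1] lat_row[of A 1]] by simp

lemma lat_int_mult: "z \<in> lat A \<Longrightarrow> of_int n * z \<in> lat A"
proof -
  assume "z \<in> lat A"
  then obtain c where "z = lincomb (xform A pb) c" by (auto simp: lat_def)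
  then have "of_int n * z = lincomb (xform A pb) (\<chi> i. n * c $ i)"
    by (simp add: lincomb_3 algebra_simps)
  then show ?thesis by (auto simp: lat_def)
qed

lemma lat_upper_iff:
  "z \<in> lat (vector [vector [1, x, s], vector [0, m, y], vector [0, 0, n]]) \<longleftrightarrow>
    (\<exists>p q r. z = el p (p * x + q * m) (p * s + q * y + r * n))" (is "z \<in> lat ?A \<longleftrightarrow> _")
proof -
  have e: "lincomb (xform ?A pb) c =
      el (c $ 1) (c $ 1 * x + c $ 2 * m) (c $ 1 * s + c $ 2 * y + c $ 3 * n)" for c
    by (simp add: lincomb_xform lincomb_pb vector_matrix_mult_def sum_3 mult_ac)
  show ?thesis
  proof
    assume "\<exists>p q r. z = el p (p * x + q * m) (p * s + q * y + r * n)"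
    then obtain p q r where "z = el p (p * x + q * m) (p * s + q * y + r * n)" by blast
    then have "z = lincomb (xform ?A pb) (vector [p, q, r])" by (simp add: e)
    then show "z \<in> lat ?A" by (simp add: lat_def)
  qed (auto simp: lat_def e)
qed

text \<open>Each row times \<alpha> is expanded in the rows again: the third gives
  \<open>m dvd n\<close>, the second gives \<open>m dvd y\<close>, the first gives \<open>t\<close>,
  and the constant coordinates of the first two give \<open>hnf_cond\<close>.\<close>

lemma alpha_stable_upper:
  assumes "m \<noteq> 0"
    and A: "A = vector [vector [1, x, s], vector [0, m, y], vector [0, 0, n]]"
    and stable: "\<And>z. z \<in> lat A \<Longrightarrow> \<alpha> * z \<in> lat A"
  obtains m2 \<mu>1 \<mu>2 t where "n = m * m2" "hnf_cond a1 a2 a3 m m2 \<mu>1 \<mu>2 t"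
    "A = root_mat a1 m m2 \<mu>1 \<mu>2 s" "s = a2 + (\<mu>1 + a1) * \<mu>1 + m * t"
proof -
  have row: "el 1 x s \<in> lat A" "el 0 m y \<in> lat A" "el 0 0 n \<in> lat A"
    using lat_row[of A 1] lat_row[of A 2] lat_row[of A 3] by (simp_all add: A lincomb_pb)
  obtain q3 where n: "n = q3 * m"
    using stable[OF row(3)] unfolding A lat_upper_iff alpha_el el_eq_iff by auto
  obtain q2 p2 where y: "y = m * x + q2 * m" and 2: "m * s + q2 * y + p2 * n = 0"
    using stable[OF row(2)] unfolding A lat_upper_iff alpha_el el_eq_iff by auto
  obtain q1 p1 where s: "s - a2 = (x - a1) * x + q1 * m"
    and 1: "- a3 = (x - a1) * s + q1 * y + p1 * n"
    using stable[OF row(1)] unfolding A lat_upper_iff alpha_el el_eq_iff by auto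
  \<comment> \<open>Read off from the target shape: the second row must be
    \<open>(0, m, - \<mu>2 * m)\<close>, and \<open>y = m * x + q2 * m\<close>.\<close>
  define \<mu>1 \<mu>2 where "\<mu>1 = x - a1" and "\<mu>2 = - (x + q2)"
  have "m * (s + q2 * (x + q2) + p2 * q3) = 0"
    using 2 unfolding n y by algebra
  then have "s + q2 * (x + q2) + p2 * q3 = 0" using assms(1) by simp
  then have "divided_diff a1 a2 \<mu>1 \<mu>2 + m * q1 = q3 * (- p2)"
    using s unfolding divided_diff_def \<mu>1_def \<mu>2_def by algebra
  moreover have "poly (cubic a1 a2 a3) \<mu>1 + m * q1 * (\<mu>1 - \<mu>2) = m * q3 * (- p1)"
    using 1 s unfolding poly_cubic \<mu>1_def \<mu>2_def n y by algebra
  ultimately have "hnf_cond a1 a2 a3 m q3 \<mu>1 \<mu>2 q1"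
    unfolding hnf_cond_def by (metis dvd_triv_left)
  moreover have "A = root_mat a1 m q3 \<mu>1 \<mu>2 s"
    unfolding A root_mat_def \<mu>1_def \<mu>2_def n y by (simp add: algebra_simps)
  moreover have "s = a2 + (\<mu>1 + a1) * \<mu>1 + m * q1"
    using s unfolding \<mu>1_def by algebra
  ultimately show ?thesis using that n by (metis mult.commute)
qed

lemma alpha_stable_hnf:
  assumes "hnf_cond a1 a2 a3 m1 m2 \<mu>1 \<mu>2 t" "z \<in> hnf m1 m2 \<mu>1 \<mu>2 t"
  shows "\<alpha> * z \<in> hnf m1 m2 \<mu>1 \<mu>2 t"
proof -
  define x s where "x = \<mu>1 + a1" and "s = a2 + x * \<mu>1 + m1 * t"
  obtain j where j: "divided_diff a1 a2 \<mu>1 \<mu>2 + m1 * t = m2 * j"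
    using assms unfolding hnf_cond_def by (elim conjE dvdE)
  obtain k where k: "poly (cubic a1 a2 a3) \<mu>1 + m1 * t * (\<mu>1 - \<mu>2) = m1 * m2 * k"
    using assms unfolding hnf_cond_def by (elim conjE dvdE)
  have hnf: "w \<in> hnf m1 m2 \<mu>1 \<mu>2 t \<longleftrightarrow>
      (\<exists>p q r. w = el p (p * x + q * m1) (p * s + q * (- \<mu>2 * m1) + r * (m1 * m2)))" for w
    unfolding hnf_def root_mat_def lat_upper_iff x_def s_def ..
  obtain p q r where z: "z = el p (p * x + q * m1) (p * s + q * (- \<mu>2 * m1) + r * (m1 * m2))"
    using assms(2) unfolding hnf by blast
  \<comment> \<open>Multiplication by \<alpha> sends the three rows to the combinations with
    coefficients \<open>(\<mu>1, t, - k)\<close>, \<open>(m1, - (\<mu>2 + x), - j)\<close> and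
    \<open>(0, m2, \<mu>2)\<close> of the rows.\<close>
  define p' q' r' where "p' = p * \<mu>1 + q * m1"
    and "q' = p * t - q * (\<mu>2 + x) + r * m2"
    and "r' = - p * k - q * j + r * \<mu>2"
  have "\<alpha> * z = el p' (p' * x + q' * m1) (p' * s + q' * (- \<mu>2 * m1) + r' * (m1 * m2))"
    unfolding z alpha_el el_eq_iff
  proof (intro conjI)
    show "p * x + q * m1 - a1 * p = p'" unfolding p'_def x_def by algebra
    show "p * s + q * (- \<mu>2 * m1) + r * (m1 * m2) - a2 * p = p' * x + q' * m1"
      unfolding p'_def q'_def s_def x_def by algebra
    show "- a3 * p = p' * s + q' * (- \<mu>2 * m1) + r' * (m1 * m2)"
      using j k unfolding p'_def q'_def r'_def s_def x_def divided_diff_def poly_cubic by algebra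
  qed
  then show ?thesis unfolding hnf by blast
qed

lemma root_mat_eqD:
  assumes "root_mat a1 m1 m2 \<mu>1 \<mu>2 s = root_mat a1 m1' m2' \<nu>1 \<nu>2 s'" "m1 \<noteq> 0"
  shows "m1' = m1 \<and> m2' = m2 \<and> \<nu>1 = \<mu>1 \<and> \<nu>2 = \<mu>2 \<and> s' = s"
  using assms by (auto simp: root_mat_def vec_eq_iff forall_3)

lemma alpha_stable_root_mat:
  assumes "m1 \<noteq> 0" and "\<And>z. z \<in> lat (root_mat a1 m1 m2 \<mu>1 \<mu>2 s) \<Longrightarrow> \<alpha> * z \<in> lat (root_mat a1 m1 m2 \<mu>1 \<mu>2 s)"
  obtains t where "hnf_cond a1 a2 a3 m1 m2 \<mu>1 \<mu>2 t" "s = a2 + (\<mu>1 + a1) * \<mu>1 + m1 * t"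
  using alpha_stable_upper[OF assms(1) root_mat_def assms(2)] root_mat_eqD assms(1) by metis

text \<open>Unipotent row operations leave the lattice unchanged. They first carry
  \<open>\<nu>1\<close> and \<open>\<nu>2\<close> to the chosen representatives, and then carry the
  resulting parameter \<open>t'\<close> to \<open>t\<close>, the two being congruent modulo
  \<open>m2\<close>.\<close>

lemma hnf_unique:
  assumes "m1 \<noteq> 0" "gcd (gcd m1 m2) (\<mu>1 - \<mu>2) = 1"
    and "hnf_cond a1 a2 a3 m1 m2 \<mu>1 \<mu>2 t"
    and "[\<nu>1 = \<mu>1] (mod m1)" "[\<nu>2 = \<mu>2] (mod m2)"
    and stable: "\<And>z. z \<in> lat (root_mat a1 m1 m2 \<nu>1 \<nu>2 s) \<Longrightarrow> \<alpha> * z \<in> lat (root_mat a1 m1 m2 \<nu>1 \<nu>2 s)"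
  shows "lat (root_mat a1 m1 m2 \<nu>1 \<nu>2 s) = hnf m1 m2 \<mu>1 \<mu>2 t"
proof -
  obtain p' where "\<nu>1 - \<mu>1 = m1 * p'"
    using assms(4) by (auto simp: cong_iff_dvd_diff)
  then obtain p where p: "\<mu>1 = \<nu>1 + p * m1"
    by (intro that[of "- p'"]) (simp add: algebra_simps)
  obtain r' where "\<nu>2 - \<mu>2 = m2 * r'"
    using assms(5) by (auto simp: cong_iff_dvd_diff)
  then obtain r where r: "\<mu>2 = \<nu>2 - r * m2"
    by (intro that[of r']) (simp add: algebra_simps)
  have u: "det (umat p q r) = 1" for p q r
    by (simp add: umat_def det_3)
  define s' where "s' = s - p * \<nu>2 * m1 + 0 * m1 * m2"
  have "umat p 0 r ** root_mat a1 m1 m2 \<nu>1 \<nu>2 s = root_mat a1 m1 m2 \<mu>1 \<mu>2 s'"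
    unfolding umat_root_mat p r s'_def ..
  then have L: "lat (root_mat a1 m1 m2 \<nu>1 \<nu>2 s) = lat (root_mat a1 m1 m2 \<mu>1 \<mu>2 s')"
    using lat_mult[OF u] by metis
  then obtain t' where t': "hnf_cond a1 a2 a3 m1 m2 \<mu>1 \<mu>2 t'" "s' = a2 + (\<mu>1 + a1) * \<mu>1 + m1 * t'"
    using alpha_stable_root_mat[OF assms(1)] stable by metis
  obtain q where q: "t' - t = m2 * q"
    using hnf_cond_unique[OF assms(1-3) t'(1)] ..
  have "umat 0 (- q) 0 ** root_mat a1 m1 m2 \<mu>1 \<mu>2 s' =
      root_mat a1 m1 m2 \<mu>1 \<mu>2 (a2 + (\<mu>1 + a1) * \<mu>1 + m1 * t)"
    unfolding umat_root_mat using q t'(2) by (simp add: algebra_simps)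
  then show ?thesis
    unfolding L hnf_def using lat_mult[OF u] by metis
qed

lemma lat_R_mult:
  assumes "\<And>z. z \<in> lat A \<Longrightarrow> \<alpha> * z \<in> lat A" "r \<in> R" "z \<in> lat A"
  shows "r * z \<in> lat A"
  using assms(2,3) unfolding R_iff
  by (auto simp: el_mult intro!: lat_add lat_int_mult assms(1))

lemma lat_subset_R: "lat A \<subseteq> R"
  by (auto simp: lat_def lincomb_xform lincomb_pb)

end

section \<open>Invertibility\<close>

context cubic_order
begin

abbreviation Inv :: "(complex^3) set \<Rightarrow> (complex^3) set" where "Inv \<equiv> ideal_inverse \<alpha>"
abbreviation Pos :: "(complex^3) set" where "Pos \<equiv> conj_space_pos r1 r2"

lemma ideal_mult_base: "x \<in> I \<Longrightarrow> y \<in> J \<Longrightarrow> x * y \<in> ideal_mult I J"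
  unfolding ideal_mult_def by (rule group_closure.base) auto

lemma ideal_mult_add: "x \<in> ideal_mult I J \<Longrightarrow> y \<in> ideal_mult I J \<Longrightarrow> x + y \<in> ideal_mult I J"
  unfolding ideal_mult_def by (rule group_closure_add)

lemma ideal_mult_diff: "x \<in> ideal_mult I J \<Longrightarrow> y \<in> ideal_mult I J \<Longrightarrow> x - y \<in> ideal_mult I J"
  unfolding ideal_mult_def by (rule group_closure.diff)

lemma ideal_mult_scale:
  assumes "w \<in> ideal_mult I J" "\<And>x. x \<in> I \<Longrightarrow> r * x \<in> I"
  shows "r * w \<in> ideal_mult I J"
  using assms(1) unfolding ideal_mult_def
proof (induction rule: group_closure.induct)
  case (base s)
  then consider "s = 0" | x y where "s = x * y" "x \<in> I" "y \<in> J" by blast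
  then show ?case
  proof cases
    case 2
    then have "r * s = (r * x) * y" by (simp add: mult.assoc)
    moreover have "r * x \<in> I" using 2 assms(2) by blast
    ultimately show ?thesis using 2(3) by (intro group_closure.base) blast
  qed simp
next
  case (diff s t)
  then show ?case by (simp add: right_diff_distrib group_closure.diff)
qed

text \<open>The multiplier \<open>u\<close> gives the lemma two uses: with \<open>u = 1\<close> the
  product lies in \<open>R\<close>, and with \<open>w = 1\<close> every multiplier of an invertible
  ideal lies in \<open>R\<close>.\<close>

lemma ideal_mult_inverse_subset:
  assumes "\<And>x. x \<in> I \<Longrightarrow> u * x \<in> I" "w \<in> ideal_mult I (Inv I)"
  shows "u * w \<in> R"
  using assms(2) unfolding ideal_mult_def
proof (induction rule: group_closure.induct)
  case (base s)
  then consider "s = 0" | x y where "s = x * y" "x \<in> I" "y \<in> Inv I" by blast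
  then show ?case
  proof cases
    case 2
    then have "u * s = y * (u * x)" by (simp add: mult_ac)
    moreover have "y * (u * x) \<in> R" using 2 assms(1)[of x] by (simp add: ideal_inverse_def)
    ultimately show ?thesis by simp
  qed simp
next
  case (diff s t)
  then show ?case by (simp add: right_diff_distrib R_diff)
qed

lemma invertible_idealsI:
  assumes "fractional_ideal \<alpha> I" "1 \<in> ideal_mult I (Inv I)"
  shows "I \<in> invertible_ideals \<alpha>"
proof -
  have "r \<in> ideal_mult I (Inv I)" if "r \<in> R" for r
    using ideal_mult_scale[OF assms(2), of r] assms(1) that by (simp add: fractional_ideal_def)
  moreover have "w \<in> R" if "w \<in> ideal_mult I (Inv I)" for w
    using ideal_mult_inverse_subset[of I 1 w] that by simp
  ultimately show ?thesis
    using assms(1) by (auto simp: invertible_ideals_def)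
qed

section \<open>The stable lattice as an ideal, and its inverse\<close>

lemma hnf_rows:
  "el 1 (\<mu>1 + a1) (a2 + (\<mu>1 + a1) * \<mu>1 + m1 * t) \<in> hnf m1 m2 \<mu>1 \<mu>2 t"
  "of_int m1 * (\<alpha> - of_int \<mu>2) \<in> hnf m1 m2 \<mu>1 \<mu>2 t"
  "of_int m1 * of_int m2 \<in> hnf m1 m2 \<mu>1 \<mu>2 t"
proof -
  let ?A = "root_mat a1 m1 m2 \<mu>1 \<mu>2 (a2 + (\<mu>1 + a1) * \<mu>1 + m1 * t)"
  have "lincomb pb (?A $ 2) = of_int m1 * (\<alpha> - of_int \<mu>2)"
    "lincomb pb (?A $ 3) = of_int m1 * of_int m2"
    by (simp_all add: lincomb_pb root_mat_def el_def algebra_simps)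
  moreover have "lincomb pb (?A $ 1) = el 1 (\<mu>1 + a1) (a2 + (\<mu>1 + a1) * \<mu>1 + m1 * t)"
    by (simp add: lincomb_pb root_mat_def)
  ultimately show
    "el 1 (\<mu>1 + a1) (a2 + (\<mu>1 + a1) * \<mu>1 + m1 * t) \<in> hnf m1 m2 \<mu>1 \<mu>2 t"
    "of_int m1 * (\<alpha> - of_int \<mu>2) \<in> hnf m1 m2 \<mu>1 \<mu>2 t"
    "of_int m1 * of_int m2 \<in> hnf m1 m2 \<mu>1 \<mu>2 t"
    unfolding hnf_def using lat_row[of ?A] by metis+
qed

lemma hnf_fractional_ideal:
  assumes "m1 \<noteq> 0" "m2 \<noteq> 0" "hnf_cond a1 a2 a3 m1 m2 \<mu>1 \<mu>2 t"
  shows "fractional_ideal \<alpha> (hnf m1 m2 \<mu>1 \<mu>2 t)"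
proof -
  let ?L = "hnf m1 m2 \<mu>1 \<mu>2 t"
  have sub: "?L \<subseteq> R" unfolding hnf_def by (rule lat_subset_R)
  have "of_int m1 * of_int m2 \<in> ?L" by (rule hnf_rows)
  then have "of_int (m1 * m2) \<in> ?L" by simp
  moreover have "of_int (m1 * m2) \<noteq> (0 :: complex^3)" using assms by (simp only: of_int_eq_0_iff) simp
  ultimately have "?L \<noteq> {0}" by auto
  moreover have "\<forall>r\<in>R. \<forall>x\<in>?L. r * x \<in> ?L"
    using lat_R_mult alpha_stable_hnf[OF assms(3)] unfolding hnf_def by blast
  moreover have "\<exists>d\<in>R. d \<noteq> 0 \<and> (\<forall>x\<in>?L. d * x \<in> R)"
    using sub by (intro bexI[of _ 1]) auto
  ultimately show ?thesis
    unfolding fractional_ideal_def using sub R_subset_K lat_0 lat_diff unfolding hnf_def by blast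
qed

text \<open>The quotient of \<open>F\<close> by \<open>X - \<mu>\<close>, evaluated at \<alpha>; the
  remainder \<open>F(\<mu>)\<close> reappears in \<open>cofactor_mult\<close>.\<close>

definition cofactor :: "int \<Rightarrow> complex^3" where
  "cofactor \<mu> = el 1 (\<mu> + a1) (\<mu>\<^sup>2 + a1 * \<mu> + a2)"

lemma cofactor_mult: "(\<alpha> - of_int \<mu>) * cofactor \<mu> = - of_int (poly (cubic a1 a2 a3) \<mu>)"
proof -
  have "(\<alpha> - of_int \<mu>) * cofactor \<mu> + of_int (poly (cubic a1 a2 a3) \<mu>) = 0"
    unfolding cofactor_def left_diff_distrib alpha_el el_scale el_diff
    unfolding el_of_int el_add el_eq_0 poly_cubic
    by (simp add: algebra_simps power2_eq_square power3_eq_cube)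
  then show ?thesis by (simp add: add_eq_0_iff2)
qed

text \<open>A second division by \<open>X - \<mu>\<close> leaves the derivative at \<mu> as
  remainder.\<close>

lemma cofactor_taylor:
  "cofactor \<mu> = (\<alpha> - of_int \<mu>) * (\<alpha> + of_int (2 * \<mu> + a1)) + of_int (divided_diff a1 a2 \<mu> \<mu>)"
  unfolding cofactor_def el_def divided_diff_def
  by (simp add: algebra_simps power2_eq_square)

lemma hnf_row1:
  "el 1 (\<mu>1 + a1) (a2 + (\<mu>1 + a1) * \<mu>1 + m1 * t) = cofactor \<mu>1 + of_int m1 * of_int t"
  by (simp add: cofactor_def el_def algebra_simps power2_eq_square)

text \<open>The first factor of the inverse carries the lattice into \<open>m1\<close> times the
  ideal \<open>(m2, \<alpha> - \<mu>2)\<close>. The set \<open>T\<close> is that target, and only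
  the three rows have to be tested.\<close>

lemma hnf_mult_subset:
  assumes hc: "hnf_cond a1 a2 a3 m1 m2 \<mu>1 \<mu>2 t"
    and z: "z \<in> hnf m1 m2 \<mu>1 \<mu>2 t" and p: "p \<in> {of_int m1, \<alpha> - of_int \<mu>1}"
  obtains u v where "u \<in> R" "v \<in> R" "z * p = of_int m1 * (u * of_int m2 + v * (\<alpha> - of_int \<mu>2))"
proof -
  define T where "T = {of_int m1 * (u * of_int m2 + v * (\<alpha> - of_int \<mu>2)) | u v. u \<in> R \<and> v \<in> R}"
  have T_add: "x + y \<in> T" if xy: "x \<in> T" "y \<in> T" for x y
  proof -
    obtain u v u' v' where uv: "u \<in> R" "v \<in> R" "u' \<in> R" "v' \<in> R"
      and x: "x = of_int m1 * (u * of_int m2 + v * (\<alpha> - of_int \<mu>2))"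
      and y: "y = of_int m1 * (u' * of_int m2 + v' * (\<alpha> - of_int \<mu>2))"
      using xy unfolding T_def by blast
    have "x + y = of_int m1 * ((u + u') * of_int m2 + (v + v') * (\<alpha> - of_int \<mu>2))"
      unfolding x y by (simp add: algebra_simps)
    moreover have "u + u' \<in> R" "v + v' \<in> R"
      using uv by (simp_all add: R_add)
    ultimately show ?thesis unfolding T_def by blast
  qed
  have T_scale: "of_int n * x \<in> T" if x: "x \<in> T" for n x
  proof -
    obtain u v where uv: "u \<in> R" "v \<in> R" and x: "x = of_int m1 * (u * of_int m2 + v * (\<alpha> - of_int \<mu>2))"
      using x unfolding T_def by blast
    have "of_int n * x = of_int m1 * ((of_int n * u) * of_int m2 + (of_int n * v) * (\<alpha> - of_int \<mu>2))"
      unfolding x by (simp add: algebra_simps)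
    moreover have "of_int n * u \<in> R" "of_int n * v \<in> R"
      using uv by (simp_all add: R_int_mult)
    ultimately show ?thesis unfolding T_def by blast
  qed
  obtain j where j: "divided_diff a1 a2 \<mu>1 \<mu>2 + m1 * t = m2 * j"
    using hc unfolding hnf_cond_def by (elim conjE dvdE)
  obtain k where k: "poly (cubic a1 a2 a3) \<mu>1 + m1 * t * (\<mu>1 - \<mu>2) = m1 * m2 * k"
    using hc unfolding hnf_cond_def by (elim conjE dvdE)
  let ?A = "root_mat a1 m1 m2 \<mu>1 \<mu>2 (a2 + (\<mu>1 + a1) * \<mu>1 + m1 * t)"
  let ?w = "cofactor \<mu>1 + of_int m1 * of_int t"
  have rows: "xform ?A pb 1 = ?w" "xform ?A pb 2 = of_int m1 * (\<alpha> - of_int \<mu>2)"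
    "xform ?A pb 3 = of_int m1 * of_int m2"
    by (simp_all add: xform_def lincomb_pb root_mat_def flip: hnf_row1)
       (simp_all add: el_def algebra_simps)
  have pR: "p \<in> R" using p by (auto intro: R_diff)
  have "?w * p \<in> T"
  proof -
    consider "p = of_int m1" | "p = \<alpha> - of_int \<mu>1" using p by blast
    then show ?thesis
    proof cases
      case 1
      \<comment> \<open>Division by \<open>\<alpha> - \<mu>2\<close>: the remainder is the quantity
        that the first half of \<open>hnf_cond\<close> makes divisible by \<open>m2\<close>.\<close>
      have "?w = of_int (divided_diff a1 a2 \<mu>1 \<mu>2 + m1 * t) + (\<alpha> + of_int (\<mu>1 + \<mu>2 + a1)) * (\<alpha> - of_int \<mu>2)"
        by (simp add: cofactor_def el_def divided_diff_def algebra_simps power2_eq_square)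
      then have "?w * p = of_int m1 * (of_int j * of_int m2 + (\<alpha> + of_int (\<mu>1 + \<mu>2 + a1)) * (\<alpha> - of_int \<mu>2))"
        by (simp only: j 1 of_int_mult) (simp only: mult_ac)
      then show ?thesis unfolding T_def by (blast intro: R_add R_alpha R_of_int)
    next
      case 2
      \<comment> \<open>Here \<open>\<alpha> - \<mu>1\<close> is split as
        \<open>(\<alpha> - \<mu>2) - (\<mu>1 - \<mu>2)\<close>, so that the integer left over is the
        one in the second half of \<open>hnf_cond\<close>.\<close>
      have "?w * p = of_int m1 * (of_int t * (\<alpha> - of_int \<mu>2)) - of_int (poly (cubic a1 a2 a3) \<mu>1 + m1 * t * (\<mu>1 - \<mu>2))"
        using cofactor_mult[of \<mu>1] by (simp add: 2 algebra_simps)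
      also have "\<dots> = of_int m1 * (of_int (- k) * of_int m2 + of_int t * (\<alpha> - of_int \<mu>2))"
        unfolding k by (simp add: algebra_simps)
      finally show ?thesis unfolding T_def by (blast intro: R_of_int)
    qed
  qed
  moreover have "of_int m1 * (\<alpha> - of_int \<mu>2) * p \<in> T"
  proof -
    have "of_int m1 * (\<alpha> - of_int \<mu>2) * p = of_int m1 * (0 * of_int m2 + p * (\<alpha> - of_int \<mu>2))"
      by (simp add: mult_ac)
    then show ?thesis unfolding T_def using pR R_0 by blast
  qed
  moreover have "of_int m1 * of_int m2 * p \<in> T"
  proof -
    have "of_int m1 * of_int m2 * p = of_int m1 * (p * of_int m2 + 0 * (\<alpha> - of_int \<mu>2))"
      by (simp add: mult_ac)
    then show ?thesis unfolding T_def using pR R_0 by blast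
  qed
  moreover obtain c where "z = lincomb (xform ?A pb) c"
    using z by (auto simp: hnf_def lat_def)
  then have "z * p = of_int (c $ 1) * (?w * p) + of_int (c $ 2) * (of_int m1 * (\<alpha> - of_int \<mu>2) * p)
      + of_int (c $ 3) * (of_int m1 * of_int m2 * p)"
    unfolding lincomb_3 rows by (simp only: distrib_right mult.assoc)
  ultimately have "z * p \<in> T" by (simp add: T_add T_scale)
  then show ?thesis using that unfolding T_def by blast
qed

text \<open>
  Up to the factor \<open>m1 * m2\<close>, the inverse of the lattice is the product of the ideals
  \<open>(m1, \<alpha> - \<mu>1)\<close> and \<open>(m2, cofactor \<mu>2)\<close>. Coprimality to the discriminant makes \<open>F'(\<mu>i)\<close> a unit
  modulo \<open>mi\<close>, so that each of \<open>(mi, \<alpha> - \<mu>i, cofactor \<mu>i)\<close> is the unit ideal.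
\<close>

lemma hnf_invertible:
  assumes nz: "m1 \<noteq> 0" "m2 \<noteq> 0" and hc: "hnf_cond a1 a2 a3 m1 m2 \<mu>1 \<mu>2 t"
    and cop: "coprime (m1 * m2) (cubic_disc a1 a2 a3)"
  shows "hnf m1 m2 \<mu>1 \<mu>2 t \<in> invertible_ideals \<alpha>"
proof (rule invertible_idealsI)
  let ?L = "hnf m1 m2 \<mu>1 \<mu>2 t"
  define M1 M2 :: "complex^3" where "M1 = of_int m1" and "M2 = of_int m2"
  define P1 P2 where "P1 = \<alpha> - of_int \<mu>1" and "P2 = \<alpha> - of_int \<mu>2"
  define \<omega> where "\<omega> = cofactor \<mu>1 + M1 * of_int t"
  show fi: "fractional_ideal \<alpha> ?L" using hnf_fractional_ideal[OF nz hc] .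
  then have scale: "r * x \<in> ?L" if "r \<in> R" "x \<in> ?L" for r x
    using that by (simp add: fractional_ideal_def)
  have L: "\<omega> \<in> ?L" "M1 * P2 \<in> ?L" "M1 * M2 \<in> ?L"
    using hnf_rows(1)[of \<mu>1 m1 t m2 \<mu>2] hnf_rows(2)[of m1 \<mu>2 m2 \<mu>1 t] hnf_rows(3)[of m1 m2 \<mu>1 \<mu>2 t]
    unfolding hnf_row1 by (simp_all add: \<omega>_def M1_def M2_def P2_def)
  have R: "M1 \<in> R" "M2 \<in> R" "P1 \<in> R" "P2 \<in> R" "cofactor \<mu> \<in> R" for \<mu>
    by (simp_all add: M1_def M2_def P1_def P2_def cofactor_def R_diff)
  have "of_int (m1 * m2) \<in> K" "of_int (m1 * m2) \<noteq> (0 :: complex^3)"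
    using R_subset_K R_of_int nz by (blast, simp only: of_int_eq_0_iff, simp)
  then obtain \<kappa> where "\<kappa> \<in> K" "of_int (m1 * m2) * \<kappa> = 1" by (rule K_inverse)
  then have \<kappa>: "\<kappa> \<in> K" "M1 * M2 * \<kappa> = 1" by (simp_all add: M1_def M2_def)
  obtain g where g: "poly (cubic a1 a2 a3) \<mu>2 = m2 * g"
    using hnf_cond_roots(2)[OF hc] by (auto simp: cong_0_iff)
  let ?J = "ideal_mult ?L (Inv ?L)"
  have inv: "\<kappa> * p * q \<in> Inv ?L" if p: "p \<in> {M1, P1}" and q: "q \<in> {M2, cofactor \<mu>2}" for p q
    unfolding ideal_inverse_def
  proof (intro CollectI conjI ballI)
    show "\<kappa> * p * q \<in> K" using \<kappa> p q R R_subset_K by (auto intro!: K_mult)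
    fix z assume "z \<in> ?L"
    then obtain u v where uv: "u \<in> R" "v \<in> R" "z * p = M1 * (u * M2 + v * P2)"
      using hnf_mult_subset[OF hc, of z p] p unfolding M1_def M2_def P1_def P2_def by metis
    obtain r where r: "r \<in> R" "(u * M2 + v * P2) * q = M2 * r"
    proof -
      consider "q = M2" | "q = cofactor \<mu>2" using q by blast
      then show ?thesis
      proof cases
        case 1
        show ?thesis
          by (rule that[of "u * M2 + v * P2"]) (use 1 uv R in \<open>auto intro!: R_add R_mult simp: mult_ac\<close>)
      next
        case 2
        have "(u * M2 + v * P2) * q = u * M2 * cofactor \<mu>2 + v * (P2 * cofactor \<mu>2)"
          by (simp add: 2 algebra_simps)
        also have "\<dots> = M2 * (u * cofactor \<mu>2 - v * of_int g)"
          unfolding P2_def cofactor_mult g by (simp add: M2_def algebra_simps)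
        finally show ?thesis
          using uv R by (intro that[of "u * cofactor \<mu>2 - v * of_int g"]) (auto intro!: R_diff R_mult)
      qed
    qed
    have "\<kappa> * p * q * z = \<kappa> * ((z * p) * q)" by (simp add: mult_ac)
    also have "\<dots> = \<kappa> * (M1 * ((u * M2 + v * P2) * q))" unfolding uv(3) by (simp add: mult_ac)
    also have "\<dots> = (M1 * M2 * \<kappa>) * r" unfolding r(2) by (simp add: mult_ac)
    finally show "\<kappa> * p * q * z \<in> R" using r \<kappa> by simp
  qed
  have J: "r * (x * (\<kappa> * p * q)) \<in> ?J"
    if "r \<in> R" "x \<in> ?L" "p \<in> {M1, P1}" "q \<in> {M2, cofactor \<mu>2}" for r x p q
    using that scale by (intro ideal_mult_scale ideal_mult_base inv) auto
  have dvd: "m1 dvd poly (cubic a1 a2 a3) \<mu>1" "m2 dvd poly (cubic a1 a2 a3) \<mu>2"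
    using hnf_cond_roots[OF hc] by (simp_all add: cong_0_iff)
  have cop': "coprime m1 (cubic_disc a1 a2 a3)" "coprime m2 (cubic_disc a1 a2 a3)"
    using cop by simp_all
  have unit: "of_int k * of_int m + of_int e * cofactor \<mu> - of_int e * (\<alpha> + of_int (2 * \<mu> + a1)) * (\<alpha> - of_int \<mu>) = 1"
    if "e * divided_diff a1 a2 \<mu> \<mu> + k * m = 1" for e k m \<mu>
  proof -
    have "of_int k * of_int m + of_int e * cofactor \<mu> - of_int e * (\<alpha> + of_int (2 * \<mu> + a1)) * (\<alpha> - of_int \<mu>)
        = (of_int (e * divided_diff a1 a2 \<mu> \<mu> + k * m) :: complex^3)"
      unfolding cofactor_taylor by (simp add: algebra_simps)
    then show ?thesis unfolding that by simp
  qed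
  obtain e1 k1 where "e1 * divided_diff a1 a2 \<mu>1 \<mu>1 + k1 * m1 = 1"
    using simple_root_mod[OF cop'(1) dvd(1)] .
  from unit[OF this] obtain H1 where H1: "H1 \<in> R" and
    one1: "of_int k1 * M1 + of_int e1 * cofactor \<mu>1 - H1 * P1 = 1"
    unfolding M1_def P1_def by (metis R_mult R_add R_alpha R_of_int)
  obtain e2 k2 where "e2 * divided_diff a1 a2 \<mu>2 \<mu>2 + k2 * m2 = 1"
    using simple_root_mod[OF cop'(2) dvd(2)] .
  from unit[OF this] obtain H2 where H2: "H2 \<in> R" and
    one2: "of_int k2 * M2 + of_int e2 * cofactor \<mu>2 - H2 * P2 = 1"
    unfolding M2_def P2_def by (metis R_mult R_add R_alpha R_of_int)
  \<comment> \<open>The unit relation at \<open>\<mu>1\<close>, multiplied by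
    \<open>\<kappa> * M1 * g' * q\<close>. The coefficient \<open>k1 - e1 * t\<close> compensates
    for the summand \<open>M1 * t\<close> by which \<omega> exceeds the cofactor.\<close>
  have step: "\<kappa> * M1 * g' * q \<in> ?J" if g': "g' \<in> {M2, P2}" and q: "q \<in> {M2, cofactor \<mu>2}" for g' q
  proof -
    have gL: "M1 * g' \<in> ?L" and gR: "g' \<in> R" using g' L R by auto
    have "of_int (k1 - e1 * t) * ((M1 * g') * (\<kappa> * M1 * q)) + (of_int e1 * g') * (\<omega> * (\<kappa> * M1 * q))
        - H1 * ((M1 * g') * (\<kappa> * P1 * q)) \<in> ?J"
      using q gL gR L H1 R_of_int[of "k1 - e1 * t"] by (intro ideal_mult_add ideal_mult_diff J) (auto intro: R_mult R_diff)
    also have "of_int (k1 - e1 * t) * ((M1 * g') * (\<kappa> * M1 * q)) + (of_int e1 * g') * (\<omega> * (\<kappa> * M1 * q))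
        - H1 * ((M1 * g') * (\<kappa> * P1 * q)) =
        \<kappa> * M1 * g' * q * (of_int k1 * M1 + of_int e1 * cofactor \<mu>1 - H1 * P1)"
      by (simp add: \<omega>_def algebra_simps)
    finally show ?thesis unfolding one1 by simp
  qed
  \<comment> \<open>Now the unit relation at \<open>\<mu>2\<close>, multiplied by
    \<open>\<kappa> * M1 * M2 = 1\<close>; each summand is an instance of
    \<open>step\<close>.\<close>
  have "of_int k2 * (\<kappa> * M1 * M2 * M2) + of_int e2 * (\<kappa> * M1 * M2 * cofactor \<mu>2)
      - H2 * (\<kappa> * M1 * P2 * M2) \<in> ?J"
    using H2 scale by (intro ideal_mult_add ideal_mult_diff ideal_mult_scale step) auto
  also have "of_int k2 * (\<kappa> * M1 * M2 * M2) + of_int e2 * (\<kappa> * M1 * M2 * cofactor \<mu>2)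
      - H2 * (\<kappa> * M1 * P2 * M2) =
      (M1 * M2 * \<kappa>) * (of_int k2 * M2 + of_int e2 * cofactor \<mu>2 - H2 * P2)"
    by (simp add: algebra_simps)
  finally show "1 \<in> ?J" unfolding one2 \<kappa> by simp
qed

end

section \<open>Narrow classes\<close>

context cubic_order
begin

section \<open>Totally positive elements\<close>

lemma Pos_mult:
  assumes "x \<in> Pos" "y \<in> Pos"
  shows "x * y \<in> Pos"
proof -
  have "0 < Re (x $ i * y $ i)" if "x $ i \<in> \<real>" "y $ i \<in> \<real>" "0 < Re (x $ i)" "0 < Re (y $ i)" for i
    using that by (auto simp: complex_is_Real_iff)
  then show ?thesis
    using assms by (auto simp: conj_space_pos_def conj_space_def)
qed

lemma Pos_inverse:
  assumes "x \<in> Pos" "x * y = 1"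
  shows "y \<in> Pos"
proof -
  have y: "y $ i = inverse (x $ i)" for i
  proof -
    have "x $ i * y $ i = 1" using arg_cong[OF assms(2), of "\<lambda>v. v $ i"] by simp
    then show ?thesis by (metis inverse_unique)
  qed
  have "0 < Re (inverse (x $ i))" if "x $ i \<in> \<real>" "0 < Re (x $ i)" for i
    using that by (auto simp: complex_is_Real_iff)
  then show ?thesis
    using assms(1) by (auto simp: conj_space_pos_def conj_space_def y)
qed

lemma Pos_of_int: "0 < n \<Longrightarrow> of_int n \<in> Pos"
  by (simp add: conj_space_pos_def conj_space_def)

lemma Pos_1: "1 \<in> Pos"
  using Pos_of_int[of 1] by simp

lemma Pos_nonzero: "x \<in> Pos \<Longrightarrow> x \<noteq> 0"
  using r_cases by (force simp: conj_space_pos_def)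

text \<open>A conjugate pair contributes a squared modulus. Membership in \<open>K\<close> keeps it
  from vanishing, since \<open>Pos\<close> restricts the signs of real coordinates only.\<close>

lemma Pos_norm:
  assumes "x \<in> Pos" "x \<in> K"
  obtains \<rho> where "0 < \<rho>" "x $ 1 * x $ 2 * x $ 3 = complex_of_real \<rho>"
proof -
  have nz: "x $ j \<noteq> 0" for j
    using K_nth_nonzero[OF assms(2) Pos_nonzero[OF assms(1)]] .
  have of_real: "x $ of_nat i = complex_of_real (Re (x $ of_nat i))" "0 < Re (x $ of_nat i)"
    if "i \<in> {1..r1}" for i
    using assms(1) that by (auto simp: conj_space_pos_def conj_space_def of_real_Re)
  show ?thesis
    using r_cases
  proof
    assume r: "r1 = 3 \<and> r2 = 0"
    have *: "x $ 1 = complex_of_real (Re (x $ 1))" "0 < Re (x $ 1)"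
      "x $ 2 = complex_of_real (Re (x $ 2))" "0 < Re (x $ 2)"
      "x $ 3 = complex_of_real (Re (x $ 3))" "0 < Re (x $ 3)"
      using of_real[of 1] of_real[of 2] of_real[of 3] r by auto
    show ?thesis
    proof (rule that)
      show "0 < Re (x $ 1) * Re (x $ 2) * Re (x $ 3)" using * by simp
      show "x $ 1 * x $ 2 * x $ 3 = complex_of_real (Re (x $ 1) * Re (x $ 2) * Re (x $ 3))"
        using * by (metis of_real_mult)
    qed
  next
    assume r: "r1 = 1 \<and> r2 = 1"
    then have 1: "x $ 1 = complex_of_real (Re (x $ 1))" "0 < Re (x $ 1)"
      using of_real[of 1] by auto
    have 3: "x $ 3 = cnj (x $ 2)"
      using assms(1) r by (auto simp: conj_space_pos_def conj_space_def)
    show ?thesis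
    proof (rule that)
      show "0 < Re (x $ 1) * (cmod (x $ 2))\<^sup>2" using 1 nz by simp
      show "x $ 1 * x $ 2 * x $ 3 = complex_of_real (Re (x $ 1) * (cmod (x $ 2))\<^sup>2)"
        by (metis 1(1) 3 complex_norm_square mult.assoc of_real_mult)
    qed
  qed
qed

lemma KPos_inverse:
  assumes "x \<in> K" "x \<in> Pos"
  obtains y where "y \<in> K" "y \<in> Pos" "x * y = 1"
  using K_inverse[OF assms(1) Pos_nonzero[OF assms(2)]] Pos_inverse[OF assms(2)] by metis

abbreviation Rel :: "((complex^3) set \<times> (complex^3) set) set" where
  "Rel \<equiv> narrow_rel r1 r2 \<alpha>"

lemma narrow_relI:
  assumes "I \<in> invertible_ideals \<alpha>" "J \<in> invertible_ideals \<alpha>" "\<xi> \<in> K" "\<xi> \<in> Pos" "J = (*) \<xi> ` I"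
  shows "(I, J) \<in> Rel"
  using assms by (auto simp: narrow_rel_def)

lemma narrow_relE:
  assumes "(I, J) \<in> Rel"
  obtains \<xi> where "I \<in> invertible_ideals \<alpha>" "J \<in> invertible_ideals \<alpha>" "\<xi> \<in> K" "\<xi> \<in> Pos" "J = (*) \<xi> ` I"
  using assms by (auto simp: narrow_rel_def)

lemma equiv_narrow_rel: "equiv (invertible_ideals \<alpha>) Rel"
proof (rule equivI)
  show "Rel \<subseteq> invertible_ideals \<alpha> \<times> invertible_ideals \<alpha>"
    by (auto simp: narrow_rel_def)
  show "refl_on (invertible_ideals \<alpha>) Rel"
  proof (rule refl_onI)
    fix I assume "I \<in> invertible_ideals \<alpha>"
    then show "(I, I) \<in> Rel"
      using R_subset_K by (intro narrow_relI[of _ _ 1] Pos_1) auto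
  qed
  show "sym Rel"
  proof (rule symI)
    fix I J assume "(I, J) \<in> Rel"
    then obtain \<xi> where \<xi>: "I \<in> invertible_ideals \<alpha>" "J \<in> invertible_ideals \<alpha>" "\<xi> \<in> K" "\<xi> \<in> Pos" "J = (*) \<xi> ` I"
      by (rule narrow_relE)
    obtain \<eta> where \<eta>: "\<eta> \<in> K" "\<eta> \<in> Pos" "\<xi> * \<eta> = 1"
      using KPos_inverse \<xi> by metis
    have "I = (*) \<eta> ` J"
      using \<eta>(3) unfolding \<xi>(5) image_image mult.assoc[symmetric] by (simp add: mult.commute)
    then show "(J, I) \<in> Rel" using \<xi> \<eta> by (intro narrow_relI)
  qed
  show "trans Rel"
  proof (rule transI)
    fix I J L assume "(I, J) \<in> Rel" "(J, L) \<in> Rel"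
    then obtain \<xi> \<eta> where \<xi>: "I \<in> invertible_ideals \<alpha>" "\<xi> \<in> K" "\<xi> \<in> Pos" "J = (*) \<xi> ` I"
      and \<eta>: "L \<in> invertible_ideals \<alpha>" "\<eta> \<in> K" "\<eta> \<in> Pos" "L = (*) \<eta> ` J"
      by (metis narrow_relE)
    then have "L = (*) (\<eta> * \<xi>) ` I" by (simp add: image_image mult.assoc)
    then show "(I, L) \<in> Rel"
      using \<xi> \<eta> by (intro narrow_relI[of _ _ "\<eta> * \<xi>"] K_mult Pos_mult)
  qed
qed

section \<open>Determinants of embedding matrices\<close>

lemma det_power_basis: "det (embedding_matrix pb) \<noteq> 0"
proof -
  have "det (embedding_matrix pb) =
      (\<alpha> $ 1 - \<alpha> $ 2) * (\<alpha> $ 1 - \<alpha> $ 3) * (\<alpha> $ 2 - \<alpha> $ 3)"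
    by (simp add: det_3 embedding_matrix_def power_basis_def) algebra
  then show ?thesis by (simp add: alpha_eq_iff)
qed

text \<open>For complex numbers \<open>sgn\<close> is the direction \<open>z / |z|\<close>, so equal
  signs make the quotient a positive real. This covers a conjugate pair as well, where the power
  basis determinant is purely imaginary.\<close>

lemma det_ratio:
  assumes "sgn (det (embedding_matrix b)) = sgn (det (embedding_matrix pb))"
  obtains \<rho> where "0 < \<rho>" "det (embedding_matrix b) = complex_of_real \<rho> * det (embedding_matrix pb)"
proof -
  let ?d = "det (embedding_matrix b)" and ?e = "det (embedding_matrix pb)"
  have "sgn ?d \<noteq> 0" unfolding assms using det_power_basis by (simp add: sgn_zero_iff)
  then have nz: "?d \<noteq> 0" "?e \<noteq> 0" using det_power_basis by auto
  have "?d = of_real (cmod ?d) * sgn ?d" "?e = of_real (cmod ?e) * sgn ?e"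
    using nz by (simp_all add: sgn_div_norm scaleR_conv_of_real)
  then have "?d * of_real (cmod ?e) = ?e * of_real (cmod ?d)" unfolding assms by algebra
  then have "?d = complex_of_real (cmod ?d / cmod ?e) * ?e"
    using nz by (simp add: field_simps)
  then show ?thesis using nz by (intro that[of "cmod ?d / cmod ?e"]) auto
qed

text \<open>The quotient of the generators maps \<open>I\<close> into itself, and the multipliers of
  an invertible ideal lie in \<open>R\<close>. Two opposite inclusions thus yield a unit.\<close>

lemma mult_image_eq_unit:
  assumes "I \<in> invertible_ideals \<alpha>" "\<xi> * \<xi>i = 1" "(*) \<eta> ` I \<subseteq> (*) \<xi> ` I"
  shows "\<eta> * \<xi>i \<in> R"
proof -
  have "\<eta> * \<xi>i * x \<in> I" if "x \<in> I" for x
  proof -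
    obtain y where y: "y \<in> I" "\<eta> * x = \<xi> * y" using assms(3) \<open>x \<in> I\<close> by blast
    have "\<eta> * \<xi>i * x = (\<eta> * x) * \<xi>i" by (simp add: mult_ac)
    also have "\<dots> = (\<xi> * \<xi>i) * y" unfolding y(2) by (simp add: mult_ac)
    finally show ?thesis using assms(2) y by simp
  qed
  moreover have "1 \<in> ideal_mult I (Inv I)"
    using assms(1) by (simp add: invertible_ideals_def)
  ultimately show ?thesis using ideal_mult_inverse_subset[of I "\<eta> * \<xi>i" 1] by simp
qed

text \<open>This is how \<xi> inherits total positivity from \<open>\<xi>'\<close>, the factor on
  which the domain condition is imposed.\<close>

lemma Pos_quotient:
  assumes "x' \<in> K" "x' \<in> Pos" "x * x' = of_int n" "0 < n"
  shows "x \<in> Pos"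
proof -
  obtain y where y: "y \<in> Pos" "x' * y = 1" using KPos_inverse assms(1,2) by metis
  have "x = (x * x') * y" using y by (simp add: mult.assoc)
  then show ?thesis unfolding assms(3) using Pos_mult[OF Pos_of_int y(1)] assms(4) by simp
qed

lemma generator_unique:
  assumes "unit_fundamental_domain r1 r2 \<alpha> Dom" "I \<in> invertible_ideals \<alpha>" "0 < n"
    and "\<xi> \<in> K" "\<eta> \<in> K" "\<xi>' \<in> Dom" "\<eta>' \<in> Dom" "\<xi> * \<xi>' = of_int n" "\<eta> * \<eta>' = of_int n"
    and "(*) \<xi> ` I = (*) \<eta> ` I"
  shows "\<xi> = \<eta>" "\<xi>' = \<eta>'"
proof -
  have Dom: "x \<in> Pos" "x \<in> K" if "x \<in> Dom" for x
    using assms(1) that unfolding unit_fundamental_domain_def by auto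
  have p: "\<xi> \<in> Pos" "\<eta> \<in> Pos"
    using Pos_quotient[OF Dom(2,1)] assms by blast+
  obtain \<xi>i where \<xi>i: "\<xi>i \<in> K" "\<xi>i \<in> Pos" "\<xi> * \<xi>i = 1"
    using KPos_inverse p assms by metis
  obtain \<eta>i where \<eta>i: "\<eta>i \<in> K" "\<eta>i \<in> Pos" "\<eta> * \<eta>i = 1"
    using KPos_inverse p assms by metis
  have R: "\<eta> * \<xi>i \<in> R" "\<xi> * \<eta>i \<in> R"
    using mult_image_eq_unit[OF assms(2)] \<xi>i \<eta>i assms(10) by blast+
  have "(\<eta> * \<xi>i) * (\<xi> * \<eta>i) = (\<xi> * \<xi>i) * (\<eta> * \<eta>i)" by (simp add: mult_ac)
  then have "(\<eta> * \<xi>i) * (\<xi> * \<eta>i) = 1" by (simp add: \<xi>i \<eta>i)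
  then have u: "\<eta> * \<xi>i \<in> pos_units r1 r2 \<alpha>"
    using R Pos_mult[OF p(2) \<xi>i(2)] unfolding pos_units_def conj_space_pos_def by blast
  \<comment> \<open>Equal products make \<open>\<xi>'\<close> and \<open>\<eta>'\<close> differ by
    the same unit as \<eta> and \<xi>, so they lie in one orbit.\<close>
  have "\<xi>' = \<xi>i * (\<xi> * \<xi>')" using \<xi>i(3) by (metis mult.assoc mult.commute mult_1_left)
  then have "\<xi>' = (\<eta> * \<xi>i) * \<eta>'" unfolding assms(8) assms(9)[symmetric] by (simp add: mult_ac)
  moreover have "(1 :: complex^3) \<in> pos_units r1 r2 \<alpha>"
    using Pos_1 by (auto simp: pos_units_def intro!: bexI[of _ 1])
  then have "\<exists>u\<in>pos_units r1 r2 \<alpha>. \<eta>' = u * \<eta>'" by (metis mult_1_left)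
  moreover have "\<exists>!y. y \<in> Dom \<and> (\<exists>u\<in>pos_units r1 r2 \<alpha>. y = u * \<eta>')"
    using assms(1) Dom[OF assms(7)] unfolding unit_fundamental_domain_def by blast
  ultimately show e: "\<xi>' = \<eta>'" using u assms(6,7) by blast
  show "\<xi> = \<eta>"
    using K_mult_cancel[of \<xi>' \<xi> \<eta>] assms(6,8,9) Dom[OF assms(6)] Pos_nonzero e
    by (metis mult.commute)
qed

end

section \<open>The correspondence\<close>

lemma column_mult: "column j (A ** B) = A *v column j B"
  for A B :: "'a::comm_semiring_1^3^3"
  by (simp add: column_def matrix_matrix_mult_def matrix_vector_mult_def vec_eq_iff)

lemma xform_inj:
  assumes "\<And>c d. lincomb b c = lincomb b d \<Longrightarrow> c = d" "xform A b = xform A' b"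
  shows "A = A'"
proof -
  have "A $ i = A' $ i" for i
    using fun_cong[OF assms(2), of i] assms(1) by (simp add: xform_def)
  then show ?thesis by (simp add: vec_eq_iff)
qed

lemma xform_exists:
  assumes "\<And>i. w i \<in> range (lincomb b)"
  obtains A where "xform A b = w"
proof -
  obtain f where f: "\<And>i. w i = lincomb b (f i)" using assms unfolding image_iff by metis
  then have "xform (\<chi> i. f i) b = w" by (simp add: xform_def fun_eq_iff)
  then show ?thesis by (rule that)
qed

lemma det_cmat: "det (cmat A) = of_int (det A)"
  by (simp add: det_3 cmat_def)

lemma det_diag_mat: "det (diag_mat v) = v $ 1 * v $ 2 * v $ 3"
  by (simp add: det_3 diag_mat_def)

lemma det_root_mat: "det (root_mat a1 m1 m2 \<mu>1 \<mu>2 s) = m1 * (m1 * m2)"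
  by (simp add: det_3 root_mat_def)

lemma column_root_mat: "column 1 (root_mat a1 m1 m2 \<mu>1 \<mu>2 s) = axis 1 1"
  by (simp add: column_def root_mat_def axis_def vec_eq_iff forall_3)

section \<open>A single narrow class with its bases\<close>

locale ideal_bases = cubic_order +
  fixes I Dom :: "(complex^3) set" and b bb :: "3 \<Rightarrow> complex^3" and B B' :: "3 \<Rightarrow> int^3^3"
  assumes invertible: "I \<in> invertible_ideals \<alpha>"
    and basis: "int_basis b I" and basis_inv: "int_basis bb (ideal_inverse \<alpha> I)"
    and sgn_det: "sgn (det (embedding_matrix b)) = sgn (det (embedding_matrix (power_basis \<alpha>)))"
    and B_eq: "bb i * b j = (\<Sum>k\<in>UNIV. of_int (B i $ j $ k) * power_basis \<alpha> k)"
    and B'_eq: "b i * power_basis \<alpha> j = (\<Sum>k\<in>UNIV. of_int (B' i $ j $ k) * b k)"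
    and fund_domain: "unit_fundamental_domain r1 r2 \<alpha> Dom"
begin

lemma lincomb_b_inj: "lincomb b c = lincomb b d \<Longrightarrow> c = d"
  and lincomb_bb_inj: "lincomb bb c = lincomb bb d \<Longrightarrow> c = d"
  and range_lincomb_b: "range (lincomb b) = I"
  and range_lincomb_bb: "range (lincomb bb) = Inv I"
  using basis basis_inv by (auto simp: int_basis_def bij_betw_def dest: injD)

lemma ideal_R_mult: "r \<in> R \<Longrightarrow> x \<in> I \<Longrightarrow> r * x \<in> I"
  using invertible by (auto simp: invertible_ideals_def fractional_ideal_def)

lemma inv_K: "x \<in> Inv I \<Longrightarrow> x \<in> K"
  by (simp add: ideal_inverse_def)

lemma Dom_K: "x \<in> Dom \<Longrightarrow> x \<in> K" and Dom_Pos: "x \<in> Dom \<Longrightarrow> x \<in> Pos"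
  using fund_domain unfolding unit_fundamental_domain_def by auto

lemma matcomb_B: "lincomb bb c * b j = lincomb pb (matcomb B c $ j)"
proof -
  have "lincomb bb c * b j = (\<Sum>i\<in>UNIV. of_int (c $ i) * (bb i * b j))"
    by (simp add: lincomb_def sum_distrib_right mult.assoc)
  also have "\<dots> = lincomb pb (matcomb B c $ j)"
    unfolding B_eq by (simp add: lincomb_3 matcomb_def sum_3 algebra_simps)
  finally show ?thesis .
qed

text \<open>The third power basis element is 1, so the third row of each \<open>B' i\<close> is a
  unit vector.\<close>

lemma row_matcomb_B': "row 3 (matcomb B' c') = c'"
proof -
  have "b i = lincomb b (B' i $ 3)" for i
    using B'_eq[of i 3] by (simp add: lincomb_def power_basis_def)
  then have "B' i $ 3 = axis i 1" for i
    using lincomb_b_inj by (metis lincomb_axis)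
  then have "c' $ i * B' i $ 3 $ k = (if i = k then c' $ i else 0)" for i k
    by (simp add: axis_def)
  then have "row 3 (matcomb B' c') $ k = (\<Sum>i\<in>UNIV. if i = k then c' $ i else 0)" for k
    by (simp add: row_def matcomb_def)
  then show ?thesis by (simp add: vec_eq_iff)
qed

lemma xform_matcomb_B: "xform (matcomb B c) pb = (\<lambda>j. lincomb bb c * b j)"
  by (simp add: xform_def matcomb_B)

lemma range_lincomb_mult: "range (lincomb (\<lambda>j. \<xi> * b j)) = (*) \<xi> ` I"
  by (simp add: lincomb_mult_left image_image flip: range_lincomb_b)

lemma lat_matcomb_B:
  assumes "det \<gamma> = 1"
  shows "lat (\<gamma> ** matcomb B c) = (*) (lincomb bb c) ` I"
  unfolding lat_mult[OF assms] unfolding lat_def xform_matcomb_B range_lincomb_mult ..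

lemma scaled_alpha_stable: "z \<in> (*) \<xi> ` I \<Longrightarrow> \<alpha> * z \<in> (*) \<xi> ` I"
  using ideal_R_mult[OF R_alpha] by (auto simp: mult.left_commute[of \<alpha>])

text \<open>Determinants are taken in \<open>embedding_matrix_eq\<close> and the power basis
  determinant is cancelled. The sign convention enters here, as positivity of \<rho>.\<close>

lemma det_matcomb_B:
  obtains \<rho> where "0 < \<rho>" "\<forall>\<gamma> c. of_int (det \<gamma>) * complex_of_real \<rho> *
      (lincomb bb c $ 1 * lincomb bb c $ 2 * lincomb bb c $ 3) = of_int (det (\<gamma> ** matcomb B c))"
proof -
  obtain \<rho> where \<rho>: "0 < \<rho>"
    "det (embedding_matrix b) = complex_of_real \<rho> * det (embedding_matrix pb)"
    using det_ratio[OF sgn_det] .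
  have "of_int (det \<gamma>) * complex_of_real \<rho> *
      (lincomb bb c $ 1 * lincomb bb c $ 2 * lincomb bb c $ 3) = of_int (det (\<gamma> ** matcomb B c))" for \<gamma> c
  proof -
    have "det (cmat \<gamma> ** embedding_matrix b ** diag_mat (lincomb bb c)) =
        det (cmat (\<gamma> ** matcomb B c) ** embedding_matrix pb)"
      by (simp only: embedding_matrix_eq[OF matcomb_B])
    then show ?thesis
      unfolding det_mul[of _ "diag_mat _"] det_mul[of "cmat _"] det_cmat det_diag_mat \<rho>(2)
      using det_power_basis by (simp add: mult_ac)
  qed
  with \<rho>(1) show ?thesis using that by blast
qed

section \<open>Admissible coefficients and their cosets\<close>

lemma admissible_iff:
  "admissible Dom b bb B B' c c' \<longleftrightarrow>
     primitive (column 1 (matcomb B c)) \<and> primitive c' \<and>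
     lincomb bb c * lincomb b c' \<in> \<int> \<and> lincomb b c' \<in> Dom"
  by (simp add: admissible_def row_matcomb_B')

lemma pairing: "lincomb pb (c' v* matcomb B c) = lincomb bb c * lincomb b c'"
  by (simp add: xform_matcomb_B lincomb_mult_left flip: lincomb_xform)

text \<open>An integral \<open>\<xi> * \<xi>'\<close> has no \<alpha>-squared coordinate, and by
  \<open>pairing\<close> this is the orthogonality of the Pluecker coordinates.\<close>

lemma admissible_coset:
  assumes "admissible Dom b bb B B' c c'"
  obtains \<gamma> n where "\<gamma> \<in> pluecker_coset (column 1 (matcomb B c)) c'"
    "lincomb bb c * lincomb b c' = of_int n"
proof -
  obtain n where n: "lincomb bb c * lincomb b c' = of_int n"
    using assms by (auto simp: admissible_iff elim: Ints_cases)
  then have "lincomb pb (c' v* matcomb B c) = el 0 0 n"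
    by (simp only: pairing el_of_int)
  then have "(c' v* matcomb B c) $ 1 = 0"
    by (simp add: lincomb_pb el_eq_iff)
  then have "column 1 (matcomb B c) $ 1 * c' $ 1 + column 1 (matcomb B c) $ 2 * c' $ 2
      + column 1 (matcomb B c) $ 3 * c' $ 3 = 0"
    by (simp add: vector_matrix_mult_def column_def sum_3 algebra_simps)
  then show ?thesis
    using pluecker_coset_exists assms that n unfolding admissible_iff by metis
qed

lemma pluecker_mult_matcomb:
  assumes \<gamma>: "\<gamma> \<in> pluecker_coset (column 1 (matcomb B c)) c'"
    and n: "lincomb bb c * lincomb b c' = of_int n"
  obtains x s m y where
    "\<gamma> ** matcomb B c = vector [vector [1, x, s], vector [0, m, y], vector [0, 0, n]]"
proof -
  let ?A = "\<gamma> ** matcomb B c"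
  have "column 1 ?A = axis 1 1"
    using \<gamma> by (simp add: pluecker_coset_iff column_mult)
  then have col: "?A $ 1 $ 1 = 1" "?A $ 2 $ 1 = 0" "?A $ 3 $ 1 = 0"
    by (simp_all add: column_def axis_def vec_eq_iff forall_3)
  have "row 3 ?A = c' v* matcomb B c"
    using \<gamma> by (simp add: pluecker_coset_iff row_mult)
  then have "lincomb pb (row 3 ?A) = el 0 0 n"
    by (simp only: pairing n el_of_int)
  then have "?A $ 3 $ 2 = 0" "?A $ 3 $ 3 = n"
    by (simp_all add: lincomb_pb el_eq_iff row_def)
  with col have "?A = vector [vector [1, ?A $ 1 $ 2, ?A $ 1 $ 3], vector [0, ?A $ 2 $ 2, ?A $ 2 $ 3],
      vector [0, 0, n]]"
    by (simp add: vec_eq_iff forall_3)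
  then show ?thesis by (rule that)
qed

lemma admissible_imp_coset_equations:
  assumes adm: "admissible Dom b bb B B' c c'"
  shows "\<exists>m1 m2 \<mu>1 \<mu>2. 0 < m1 \<and> m2 \<noteq> 0 \<and>
    (lincomb bb c * lincomb b c' \<in> of_int ` {0<..} \<longrightarrow> 0 < m2) \<and>
    [poly (cubic a1 a2 a3) \<mu>1 = 0] (mod m1) \<and> [poly (cubic a1 a2 a3) \<mu>2 = 0] (mod m2) \<and>
    coset_equations a1 pb b bb B c
      (pluecker_coset (column 1 (matcomb B c)) (row 3 (matcomb B' c'))) m1 m2 \<mu>1 \<mu>2"
proof -
  let ?\<xi> = "lincomb bb c" and ?\<xi>' = "lincomb b c'"
  obtain \<gamma> n where \<gamma>: "\<gamma> \<in> pluecker_coset (column 1 (matcomb B c)) c'" and n: "?\<xi> * ?\<xi>' = of_int n"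
    using admissible_coset[OF adm] .
  obtain x s m y where A:
    "\<gamma> ** matcomb B c = vector [vector [1, x, s], vector [0, m, y], vector [0, 0, n]]"
    using pluecker_mult_matcomb[OF \<gamma> n] .
  have det: "det \<gamma> = 1" using \<gamma> by (simp add: pluecker_coset_iff)
  note lat = lat_matcomb_B[OF det, of c]
  have \<xi>': "?\<xi>' \<in> K" "?\<xi>' \<in> Pos" using adm Dom_K Dom_Pos by (auto simp: admissible_iff)
  have "?\<xi> \<in> Inv I" by (simp flip: range_lincomb_bb)
  then have \<xi>: "?\<xi> \<in> K" by (rule inv_K)
  have "?\<xi> \<noteq> 0"
  proof
    assume "?\<xi> = 0"
    then have "lat (\<gamma> ** matcomb B c) \<subseteq> {0}" unfolding lat by auto
    moreover have "el 1 x s \<in> lat (\<gamma> ** matcomb B c)"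
      using lat_row[of "\<gamma> ** matcomb B c" 1] by (simp add: A lincomb_pb)
    ultimately show False using el_eq_0[of 1 x s] by auto
  qed
  have "n \<noteq> 0"
  proof
    assume "n = 0"
    then have "?\<xi> * ?\<xi>' = 0" unfolding n by simp
    then show False
      using \<open>?\<xi> \<noteq> 0\<close> Pos_nonzero[OF \<xi>'(2)] K_mult_eq_0[OF \<xi>, of ?\<xi>'] by blast
  qed
  obtain \<rho> where \<rho>: "0 < \<rho>" "\<forall>\<gamma> c. of_int (det \<gamma>) * complex_of_real \<rho> *
      (lincomb bb c $ 1 * lincomb bb c $ 2 * lincomb bb c $ 3) = of_int (det (\<gamma> ** matcomb B c))"
    using det_matcomb_B .
  obtain \<sigma> where \<sigma>: "0 < \<sigma>" "?\<xi>' $ 1 * ?\<xi>' $ 2 * ?\<xi>' $ 3 = complex_of_real \<sigma>"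
    using Pos_norm[OF \<xi>'(2,1)] .
  have nth: "?\<xi> $ j * ?\<xi>' $ j = of_int n" for j
    using arg_cong[OF n, of "\<lambda>v. v $ j"] by simp
  have "det (\<gamma> ** matcomb B c) = m * n" unfolding A by (simp add: det_3)
  then have norm: "complex_of_real \<rho> * (?\<xi> $ 1 * ?\<xi> $ 2 * ?\<xi> $ 3) = of_int m * of_int n"
    using \<rho>(2)[rule_format, of \<gamma> c] det by simp
  \<comment> \<open>Multiplying \<open>norm\<close> by the norm \<sigma> of \<open>\<xi>'\<close>
    and cancelling one \<open>n\<close> leaves \<open>\<rho> * n * n = m * \<sigma>\<close>. The
    square gives \<open>0 < m\<close> whatever the sign of \<open>n\<close>, which passes to
    \<open>m2\<close>.\<close>
  have "complex_of_real \<rho> * (of_int n * of_int n * of_int n) =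
      complex_of_real \<rho> * ((?\<xi> $ 1 * ?\<xi>' $ 1) * (?\<xi> $ 2 * ?\<xi>' $ 2) * (?\<xi> $ 3 * ?\<xi>' $ 3))"
    by (simp only: nth)
  also have "\<dots> = (complex_of_real \<rho> * (?\<xi> $ 1 * ?\<xi> $ 2 * ?\<xi> $ 3)) * (?\<xi>' $ 1 * ?\<xi>' $ 2 * ?\<xi>' $ 3)"
    by (simp only: mult_ac)
  also have "\<dots> = of_int m * of_int n * complex_of_real \<sigma>"
    by (simp only: norm \<sigma>(2))
  finally have "complex_of_real \<rho> * (of_int n * of_int n) = of_int m * complex_of_real \<sigma>"
    using \<open>n \<noteq> 0\<close> by simp
  then have "complex_of_real (\<rho> * (of_int n * of_int n)) = complex_of_real (of_int m * \<sigma>)"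
    by simp
  then have eq: "\<rho> * (of_int n * of_int n) = of_int m * \<sigma>"
    by (simp only: of_real_eq_iff)
  have "0 < real_of_int n * real_of_int n"
    using \<open>n \<noteq> 0\<close> by (metis not_real_square_gt_zero of_int_eq_0_iff)
  then have "0 < \<rho> * (of_int n * of_int n)"
    using \<rho>(1) by (rule mult_pos_pos[rotated])
  then have "0 < of_int m * \<sigma>" unfolding eq .
  then have "0 < m" using zero_less_mult_pos2[OF _ \<sigma>(1)] by (metis of_int_0_less_iff)
  have "\<alpha> * z \<in> lat (\<gamma> ** matcomb B c)" if "z \<in> lat (\<gamma> ** matcomb B c)" for z
    using that scaled_alpha_stable unfolding lat by blast
  then obtain m2 \<mu>1 \<mu>2 t where m2: "n = m * m2" "hnf_cond a1 a2 a3 m m2 \<mu>1 \<mu>2 t"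
    "\<gamma> ** matcomb B c = root_mat a1 m m2 \<mu>1 \<mu>2 s"
    using alpha_stable_upper[OF _ A] \<open>0 < m\<close> by (metis less_irrefl)
  have "0 < m2" if pos: "?\<xi> * ?\<xi>' \<in> of_int ` {0<..}"
  proof -
    obtain k :: int where k: "0 < k" "?\<xi> * ?\<xi>' = of_int k" using pos by auto
    have "n = k" using k(2) unfolding n by (simp only: of_int_eq_iff)
    with k \<open>0 < m\<close> m2(1) show ?thesis by (simp add: zero_less_mult_iff)
  qed
  moreover have "coset_equations a1 pb b bb B c
      (pluecker_coset (column 1 (matcomb B c)) (row 3 (matcomb B' c'))) m m2 \<mu>1 \<mu>2"
    unfolding row_matcomb_B' coset_equations_iff[OF matcomb_B \<gamma>] using m2(3) by (metis cong_refl)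
  ultimately show ?thesis
    using \<open>0 < m\<close> \<open>n \<noteq> 0\<close> m2(1) hnf_cond_roots[OF m2(2)] by (intro exI conjI impI) auto
qed

text \<open>The right-hand sides do not mention the class, so solutions attached to different
  classes can be compared through them.\<close>

lemma coset_equations_imp_lattice:
  assumes adm: "admissible Dom b bb B B' c c'"
    and eqs: "coset_equations a1 pb b bb B c
      (pluecker_coset (column 1 (matcomb B c)) (row 3 (matcomb B' c'))) m1 m2 \<mu>1 \<mu>2"
    and m: "m1 \<noteq> 0" "gcd (gcd m1 m2) (\<mu>1 - \<mu>2) = 1" "hnf_cond a1 a2 a3 m1 m2 \<mu>1 \<mu>2 t"
  shows "(*) (lincomb bb c) ` I = hnf m1 m2 \<mu>1 \<mu>2 t"
    and "lincomb bb c * lincomb b c' = of_int (m1 * m2)"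
proof -
  obtain \<gamma> n where \<gamma>: "\<gamma> \<in> pluecker_coset (column 1 (matcomb B c)) c'"
    and n: "lincomb bb c * lincomb b c' = of_int n"
    using admissible_coset[OF adm] .
  have det: "det \<gamma> = 1" using \<gamma> by (simp add: pluecker_coset_iff)
  obtain \<nu>1 \<nu>2 s where \<nu>: "[\<nu>1 = \<mu>1] (mod m1)" "[\<nu>2 = \<mu>2] (mod m2)"
    "root_mat a1 m1 m2 \<nu>1 \<nu>2 s = \<gamma> ** matcomb B c"
    using eqs unfolding row_matcomb_B' coset_equations_iff[OF matcomb_B \<gamma>] by blast
  have "lat (root_mat a1 m1 m2 \<nu>1 \<nu>2 s) = (*) (lincomb bb c) ` I"
    unfolding \<nu>(3) lat_matcomb_B[OF det] ..
  with hnf_unique[OF m \<nu>(1,2), of s] scaled_alpha_stable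
  show "(*) (lincomb bb c) ` I = hnf m1 m2 \<mu>1 \<mu>2 t" by metis
  obtain x' s' m' y' where "\<gamma> ** matcomb B c = vector [vector [1, x', s'], vector [0, m', y'], vector [0, 0, n]]"
    using pluecker_mult_matcomb[OF \<gamma> n] .
  then have "(root_mat a1 m1 m2 \<nu>1 \<nu>2 s) $ 3 $ 3 = n" unfolding \<nu>(3) by simp
  then have "n = m1 * m2" by (simp add: root_mat_def)
  with n show "lincomb bb c * lincomb b c' = of_int (m1 * m2)" by simp
qed

lemma lattice_imp_admissible:
  assumes m: "0 < m1" "0 < m2" and hc: "hnf_cond a1 a2 a3 m1 m2 \<mu>1 \<mu>2 t"
    and \<xi>0: "\<xi>0 \<in> K" "\<xi>0 \<in> Pos" "hnf m1 m2 \<mu>1 \<mu>2 t = (*) \<xi>0 ` I"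
  shows "\<exists>c c'. admissible Dom b bb B B' c c' \<and> coset_equations a1 pb b bb B c
      (pluecker_coset (column 1 (matcomb B c)) (row 3 (matcomb B' c'))) m1 m2 \<mu>1 \<mu>2"
proof -
  let ?L = "hnf m1 m2 \<mu>1 \<mu>2 t" and ?n = "of_int (m1 * m2) :: complex^3"
  define s where "s = a2 + (\<mu>1 + a1) * \<mu>1 + m1 * t"
  define Rm where "Rm = root_mat a1 m1 m2 \<mu>1 \<mu>2 s"
  have L: "?L = lat Rm" unfolding hnf_def Rm_def s_def ..
  obtain \<eta> where \<eta>: "\<eta> \<in> K" "\<eta> \<in> Pos" "\<xi>0 * \<eta> = 1" using KPos_inverse[OF \<xi>0(1,2)] .
  have "?n * \<eta> \<in> Pos"
    by (rule Pos_mult[OF Pos_of_int \<eta>(2)]) (use m in simp)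
  moreover have "?n * \<eta> \<in> K"
    by (rule K_mult[OF subsetD[OF R_subset_K R_of_int] \<eta>(1)])
  ultimately have "\<exists>!y. y \<in> Dom \<and> (\<exists>u\<in>pos_units r1 r2 \<alpha>. y = u * (?n * \<eta>))"
    using fund_domain unfolding unit_fundamental_domain_def by blast
  from ex1_implies_ex[OF this]
  obtain \<xi>' u where \<xi>': "\<xi>' \<in> Dom" and u: "u \<in> pos_units r1 r2 \<alpha>" "\<xi>' = u * (?n * \<eta>)"
    by blast
  obtain v where v: "u \<in> R" "v \<in> R" "u * v = 1" "u \<in> Pos"
    using u(1) unfolding pos_units_def by blast
  \<comment> \<open>Moving \<open>n / \<xi>0\<close> into the domain costs the unit
    \<open>u\<close>; its inverse \<open>v\<close> restores the product and leaves the ideal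
    unchanged.\<close>
  define \<xi> where "\<xi> = v * \<xi>0"
  have "v \<in> Pos" using Pos_inverse v by blast
  then have \<xi>: "\<xi> \<in> Pos" "\<xi> \<in> K"
    unfolding \<xi>_def using \<xi>0 v R_subset_K by (auto intro: Pos_mult K_mult)
  have "\<xi> * \<xi>' = (u * v) * (\<xi>0 * \<eta>) * ?n" unfolding \<xi>_def u(2) by (simp only: mult_ac)
  then have prod: "\<xi> * \<xi>' = ?n" by (simp add: v(3) \<eta>(3))
  have "(*) v ` I = I"
  proof (intro subset_antisym subsetI)
    fix x assume "x \<in> I"
    then have "u * x \<in> I" using v ideal_R_mult by blast
    moreover have "x = v * (u * x)" using v(3) by (metis mult.assoc mult.commute mult_1_left)
    ultimately show "x \<in> (*) v ` I" by blast
  qed (use ideal_R_mult v in auto)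
  moreover have "(*) \<xi> ` I = (*) \<xi>0 ` ((*) v ` I)"
    by (simp add: image_image \<xi>_def mult_ac)
  ultimately have L\<xi>: "?L = (*) \<xi> ` I"
    unfolding \<xi>0(3) by simp
  have cancel: "\<xi> * x = \<xi> * y \<Longrightarrow> x = y" for x y
    using K_mult_cancel \<xi> Pos_nonzero by blast
  have "?L \<subseteq> R" unfolding L by (rule lat_subset_R)
  then have "\<xi> \<in> Inv I"
    unfolding ideal_inverse_def L\<xi> using \<xi> by auto
  then obtain c where c: "lincomb bb c = \<xi>" using range_lincomb_bb by (metis rangeE)
  have "?n \<in> ?L" using hnf_rows(3)[of m1 m2] by simp
  then have "\<xi>' \<in> I" unfolding L\<xi> using prod cancel by (metis imageE)
  then obtain c' where c': "lincomb b c' = \<xi>'" using range_lincomb_b by (metis rangeE)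
  let ?b = "\<lambda>j. \<xi> * b j"
  have b_inj: "lincomb ?b d = lincomb ?b d' \<Longrightarrow> d = d'" for d d'
    unfolding lincomb_mult_left using cancel lincomb_b_inj by blast
  have rb: "range (lincomb ?b) = ?L" unfolding range_lincomb_mult L\<xi> ..
  have xb: "xform (matcomb B c) pb = ?b" unfolding xform_matcomb_B c ..
  have "xform Rm pb i \<in> range (lincomb ?b)" for i
    unfolding rb L xform_def by (rule lat_row)
  \<comment> \<open>Two integral bases of one lattice: \<gamma> and \<delta> convert between them,
    which leaves only the sign of \<open>det \<gamma>\<close> open. Positive norms settle it
    below.\<close>
  then obtain \<gamma> where \<gamma>: "xform \<gamma> ?b = xform Rm pb" by (rule xform_exists)
  have "?b i \<in> range (lincomb (xform Rm pb))" for i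
    unfolding lat_def[symmetric] L[symmetric] rb[symmetric] by (metis lincomb_axis rangeI)
  then obtain \<delta> where \<delta>: "xform \<delta> (xform Rm pb) = ?b" by (rule xform_exists)
  have \<gamma>C: "\<gamma> ** matcomb B c = Rm"
    using \<gamma> unfolding xb[symmetric] xform_mult by (intro xform_inj[OF inj_lincomb_pb])
  have "xform (\<delta> ** \<gamma>) ?b = xform (mat 1) ?b"
    unfolding xform_mult[symmetric] \<gamma> \<delta> xform_1 ..
  then have "\<delta> ** \<gamma> = mat 1" by (intro xform_inj[OF b_inj])
  then have "det \<delta> * det \<gamma> = 1" by (metis det_mul det_I)
  then have "det \<gamma> = 1 \<or> det \<gamma> = - 1" by (auto simp: zmult_eq_1_iff)
  moreover have "0 < det \<gamma>"
  proof -
    obtain \<rho> where \<rho>: "0 < \<rho>" "\<forall>\<gamma> c. of_int (det \<gamma>) * complex_of_real \<rho> *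
        (lincomb bb c $ 1 * lincomb bb c $ 2 * lincomb bb c $ 3) = of_int (det (\<gamma> ** matcomb B c))"
      using det_matcomb_B .
    obtain \<sigma> where \<sigma>: "0 < \<sigma>" "\<xi> $ 1 * \<xi> $ 2 * \<xi> $ 3 = complex_of_real \<sigma>"
      using Pos_norm[OF \<xi>] .
    have "complex_of_real (of_int (det \<gamma>) * \<rho> * \<sigma>) = complex_of_real (of_int (m1 * (m1 * m2)))"
      using \<rho>(2)[rule_format, of \<gamma> c] unfolding \<gamma>C c \<sigma>(2) Rm_def det_root_mat by simp
    then have "of_int (det \<gamma>) * \<rho> * \<sigma> = of_int (m1 * (m1 * m2))"
      by (simp only: of_real_eq_iff)
    moreover have "0 < real_of_int (m1 * (m1 * m2))" using m by simp
    ultimately have "0 < of_int (det \<gamma>) * (\<rho> * \<sigma>)" by (simp add: mult.assoc)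
    then have "0 < real_of_int (det \<gamma>)"
      using mult_pos_pos[OF \<rho>(1) \<sigma>(1)] by (rule zero_less_mult_pos2)
    then show ?thesis by simp
  qed
  ultimately have det: "det \<gamma> = 1" by auto
  \<comment> \<open>The last row of \<gamma> expresses \<open>m1 * m2 = \<xi> * \<xi>'\<close> in
    the basis \<open>\<xi> * b j\<close>; cancelling \<xi> identifies it with
    \<open>c'\<close>.\<close>
  have "lincomb ?b (\<gamma> $ 3) = lincomb pb (Rm $ 3)"
    using fun_cong[OF \<gamma>, of 3] by (simp add: xform_def)
  also have "\<dots> = ?n" by (simp add: lincomb_pb Rm_def root_mat_def el_def)
  finally have "lincomb b (\<gamma> $ 3) = lincomb b c'"
    unfolding lincomb_mult_left c' using cancel prod by metis
  then have "\<gamma> $ 3 = c'" by (rule lincomb_b_inj)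
  then have row: "row 3 \<gamma> = c'" by (simp add: row_def)
  have col: "\<gamma> *v column 1 (matcomb B c) = axis 1 1"
    unfolding column_mult[symmetric] \<gamma>C Rm_def by (rule column_root_mat)
  have \<gamma>_coset: "\<gamma> \<in> pluecker_coset (column 1 (matcomb B c)) c'"
    using det row col by (simp add: pluecker_coset_iff)
  have "primitive (column 1 (matcomb B c))"
    using arg_cong[OF col, of "\<lambda>v. v $ 1"]
    by (intro primitiveI[of "\<gamma> $ 1 $ 1" _ "\<gamma> $ 1 $ 2" "\<gamma> $ 1 $ 3"])
       (simp add: matrix_vector_mult_def sum_3 axis_def)
  moreover have "primitive c'"
    \<comment> \<open>The Bezout coefficients are the cofactors of \<open>det \<gamma> = 1\<close>
      along its third row.\<close>
    unfolding row[symmetric] using det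
    by (intro primitiveI[of "\<gamma> $ 1 $ 2 * \<gamma> $ 2 $ 3 - \<gamma> $ 1 $ 3 * \<gamma> $ 2 $ 2" _
          "\<gamma> $ 1 $ 3 * \<gamma> $ 2 $ 1 - \<gamma> $ 1 $ 1 * \<gamma> $ 2 $ 3" "\<gamma> $ 1 $ 1 * \<gamma> $ 2 $ 2 - \<gamma> $ 1 $ 2 * \<gamma> $ 2 $ 1"])
       (simp add: det_3 row_def algebra_simps)
  ultimately have "admissible Dom b bb B B' c c'"
    unfolding admissible_iff c c' prod using \<xi>' by simp
  moreover have "coset_equations a1 pb b bb B c
      (pluecker_coset (column 1 (matcomb B c)) (row 3 (matcomb B' c'))) m1 m2 \<mu>1 \<mu>2"
    unfolding row_matcomb_B' coset_equations_iff[OF matcomb_B \<gamma>_coset] \<gamma>C Rm_def by (metis cong_refl)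
  ultimately show ?thesis by blast
qed

end

section \<open>Assembly over all narrow classes\<close>

theorem theorem6:
  fixes a1 a2 a3 :: int
    and r1 r2 :: nat
    and \<alpha> :: "complex^3"
    and I :: "nat \<Rightarrow> (complex^3) set"
    and \<beta> \<beta>bar :: "nat \<Rightarrow> 3 \<Rightarrow> complex^3"
    and B B' :: "nat \<Rightarrow> 3 \<Rightarrow> int^3^3"
    and Dom :: "(complex^3) set"
    and F :: "int poly"
    and h :: nat
  assumes F: "F = cubic a1 a2 a3"
    and h: "h = narrow_class_number r1 r2 \<alpha>"
    and irr: "irreducible F"
    and \<alpha>: "embedding_vector F r1 r2 \<alpha>"
    and reps: "narrow_class_reps r1 r2 \<alpha> I"
    and I1: "I 1 = order_ring \<alpha>"
    and basis: "\<And>l. l \<in> {1..h} \<Longrightarrow> int_basis (\<beta> l) (I l)"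
    and basis1: "\<beta> 1 = power_basis \<alpha>"
    and sign: "\<And>l. l \<in> {1..h} \<Longrightarrow>
      sgn (det (embedding_matrix (\<beta> l))) = sgn (det (embedding_matrix (\<beta> 1)))"
    and basis_inv: "\<And>l. l \<in> {1..h} \<Longrightarrow> int_basis (\<beta>bar l) (ideal_inverse \<alpha> (I l))"
    and B: "\<And>l i j. l \<in> {1..h} \<Longrightarrow>
      \<beta>bar l i * \<beta> l j = (\<Sum>k\<in>UNIV. of_int (B l i $ j $ k) * power_basis \<alpha> k)"
    and B': "\<And>l i j. l \<in> {1..h} \<Longrightarrow>
      \<beta> l i * power_basis \<alpha> j = (\<Sum>k\<in>UNIV. of_int (B' l i $ j $ k) * \<beta> l k)"
    and Dom: "unit_fundamental_domain r1 r2 \<alpha> Dom"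
  shows
    "(\<forall>l \<in> {1..h}. \<forall>c c'.
        admissible Dom (\<beta> l) (\<beta>bar l) (B l) (B' l) c c' \<longrightarrow>
        (\<exists>m1 m2 \<mu>1 \<mu>2. 0 < m1 \<and> m2 \<noteq> 0 \<and>
           (lincomb (\<beta>bar l) c * lincomb (\<beta> l) c' \<in> of_int ` {0<..} \<longrightarrow> 0 < m2) \<and>
           [poly F \<mu>1 = 0] (mod m1) \<and> [poly F \<mu>2 = 0] (mod m2) \<and>
           coset_equations a1 (\<beta> 1) (\<beta> l) (\<beta>bar l) (B l) c
             (pluecker_coset (column 1 (matcomb (B l) c)) (row 3 (matcomb (B' l) c')))
             m1 m2 \<mu>1 \<mu>2))
     \<and>
     (\<forall>m1 m2 \<mu>1 \<mu>2.
        0 < m1 \<and> 0 < m2 \<and> gcd (m1 * m2) (cubic_disc a1 a2 a3) = 1 \<and>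
        [poly F \<mu>1 = 0] (mod m1) \<and> [poly F \<mu>2 = 0] (mod m2) \<and>
        gcd (gcd m1 m2) (\<mu>1 - \<mu>2) = 1 \<longrightarrow>
        (\<exists>!(l, c, c'). l \<in> {1..h} \<and>
           admissible Dom (\<beta> l) (\<beta>bar l) (B l) (B' l) c c' \<and>
           coset_equations a1 (\<beta> 1) (\<beta> l) (\<beta>bar l) (B l) c
             (pluecker_coset (column 1 (matcomb (B l) c)) (row 3 (matcomb (B' l) c')))
             m1 m2 \<mu>1 \<mu>2))"
proof -
  interpret cubic_order a1 a2 a3 r1 r2 \<alpha>
    using irr \<alpha> unfolding F by unfold_locales
  have inv: "I l \<in> invertible_ideals \<alpha>" if "l \<in> {1..h}" for l
    using reps that unfolding narrow_class_reps_def h by blast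
  have bij: "bij_betw (\<lambda>l. narrow_rel r1 r2 \<alpha> `` {I l}) {1..h} (narrow_classes r1 r2 \<alpha>)"
    using reps unfolding narrow_class_reps_def h by blast
  have bases: "ideal_bases a1 a2 a3 r1 r2 \<alpha> (I l) Dom (\<beta> l) (\<beta>bar l) (B l) (B' l)" if "l \<in> {1..h}" for l
    using inv[OF that] basis[OF that] basis_inv[OF that] sign[OF that] B[OF that] B'[OF that] Dom
    unfolding basis1 by unfold_locales
  have part2: "\<exists>!(l, c, c'). l \<in> {1..h} \<and>
           admissible Dom (\<beta> l) (\<beta>bar l) (B l) (B' l) c c' \<and>
           coset_equations a1 (\<beta> 1) (\<beta> l) (\<beta>bar l) (B l) c
             (pluecker_coset (column 1 (matcomb (B l) c)) (row 3 (matcomb (B' l) c')))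
             m1 m2 \<mu>1 \<mu>2"
    if m: "0 < m1" "0 < m2" and cop: "gcd (m1 * m2) (cubic_disc a1 a2 a3) = 1"
      and roots: "[poly F \<mu>1 = 0] (mod m1)" "[poly F \<mu>2 = 0] (mod m2)"
      and gcd: "gcd (gcd m1 m2) (\<mu>1 - \<mu>2) = 1" for m1 m2 \<mu>1 \<mu>2
  proof -
    let ?P = "\<lambda>(l, c, c'). l \<in> {1..h} \<and>
           admissible Dom (\<beta> l) (\<beta>bar l) (B l) (B' l) c c' \<and>
           coset_equations a1 (\<beta> 1) (\<beta> l) (\<beta>bar l) (B l) c
             (pluecker_coset (column 1 (matcomb (B l) c)) (row 3 (matcomb (B' l) c')))
             m1 m2 \<mu>1 \<mu>2"
    have m_nz: "m1 \<noteq> 0" "m2 \<noteq> 0" using m by simp_all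
    obtain t where t: "hnf_cond a1 a2 a3 m1 m2 \<mu>1 \<mu>2 t"
      using hnf_cond_exists[OF m_nz(1) _ _ gcd] roots unfolding F by blast
    define L where "L = hnf m1 m2 \<mu>1 \<mu>2 t"
    have L: "L \<in> invertible_ideals \<alpha>"
      unfolding L_def using hnf_invertible[OF m_nz t] cop by (simp add: coprime_iff_gcd_eq_1)
    have "narrow_rel r1 r2 \<alpha> `` {L} \<in> narrow_classes r1 r2 \<alpha>"
      unfolding narrow_classes_def using L by (rule quotientI)
    then obtain l where l: "l \<in> {1..h}" "narrow_rel r1 r2 \<alpha> `` {I l} = narrow_rel r1 r2 \<alpha> `` {L}"
      using bij unfolding bij_betw_def by (metis (no_types, lifting) imageE)
    then have "(I l, L) \<in> narrow_rel r1 r2 \<alpha>"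
      using equiv_class_eq_iff[OF equiv_narrow_rel, of "I l" L] inv L by blast
    then obtain \<xi>0 where "\<xi>0 \<in> number_field \<alpha>" "\<xi>0 \<in> conj_space_pos r1 r2" "L = (*) \<xi>0 ` I l"
      by (rule narrow_relE)
    then obtain c c' where "?P (l, c, c')"
      using ideal_bases.lattice_imp_admissible[OF bases[OF l(1)] m t] l(1)
      unfolding basis1 L_def by blast
    moreover have "k = l \<and> d = c \<and> d' = c'"
      if P: "?P (l, c, c')" and Q: "?P (k, d, d')" for l c c' k d d'
    proof -
      \<comment> \<open>Stated for an arbitrary solution, so that it applies to both competitors
        before their classes are known to agree.\<close>
      have D: "(*) (lincomb (\<beta>bar l) c) ` I l = L \<and>
          lincomb (\<beta>bar l) c * lincomb (\<beta> l) c' = of_int (m1 * m2) \<and>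
          lincomb (\<beta>bar l) c \<in> number_field \<alpha> \<and> lincomb (\<beta> l) c' \<in> Dom \<and>
          lincomb (\<beta>bar l) c \<in> conj_space_pos r1 r2" if P: "?P (l, c, c')" for l c c'
      proof -
        interpret l: ideal_bases a1 a2 a3 r1 r2 \<alpha> "I l" Dom "\<beta> l" "\<beta>bar l" "B l" "B' l"
          using bases P by blast
        have "(*) (lincomb (\<beta>bar l) c) ` I l = L"
          "lincomb (\<beta>bar l) c * lincomb (\<beta> l) c' = of_int (m1 * m2)"
          using l.coset_equations_imp_lattice[OF _ _ m_nz(1) gcd t, of c c'] P
          unfolding basis1 L_def by auto
        moreover have "lincomb (\<beta>bar l) c \<in> number_field \<alpha>"
          using l.inv_K l.range_lincomb_bb by blast
        moreover have \<xi>': "lincomb (\<beta> l) c' \<in> Dom"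
          using P l.admissible_iff by blast
        moreover have "lincomb (\<beta>bar l) c \<in> conj_space_pos r1 r2"
          using Pos_quotient[OF l.Dom_K[OF \<xi>'] l.Dom_Pos[OF \<xi>'] calculation(2)] m by simp
        ultimately show ?thesis by blast
      qed
      have rel: "(I l, L) \<in> narrow_rel r1 r2 \<alpha>" if P: "?P (l, c, c')" for l c c'
      proof (rule narrow_relI[of _ _ "lincomb (\<beta>bar l) c"])
        show "I l \<in> invertible_ideals \<alpha>" using inv P by blast
      qed (use L D[OF P] in simp_all)
      have "(I l, L) \<in> narrow_rel r1 r2 \<alpha>" "(I k, L) \<in> narrow_rel r1 r2 \<alpha>"
        using rel[OF P] rel[OF Q] .
      then have "narrow_rel r1 r2 \<alpha> `` {I l} = narrow_rel r1 r2 \<alpha> `` {I k}"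
        using equiv_class_eq[OF equiv_narrow_rel] by metis
      moreover have lk: "l \<in> {1..h}" "k \<in> {1..h}" using P Q by blast+
      ultimately have k: "k = l"
        using inj_onD[OF bij_betw_imp_inj_on[OF bij]] by metis
      interpret l: ideal_bases a1 a2 a3 r1 r2 \<alpha> "I l" Dom "\<beta> l" "\<beta>bar l" "B l" "B' l"
        using bases P by blast
      have "lincomb (\<beta>bar l) d = lincomb (\<beta>bar l) c" "lincomb (\<beta> l) d' = lincomb (\<beta> l) c'"
        using generator_unique[OF Dom l.invertible, of "m1 * m2"] D[OF P] D[OF Q] m unfolding k by auto
      then show ?thesis using k l.lincomb_b_inj l.lincomb_bb_inj by blast
    qed
    ultimately show ?thesis by (intro ex1I[of _ "(l, c, c')"]) auto
  qed
  have part1: "\<exists>m1 m2 \<mu>1 \<mu>2. 0 < m1 \<and> m2 \<noteq> 0 \<and>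
           (lincomb (\<beta>bar l) c * lincomb (\<beta> l) c' \<in> of_int ` {0<..} \<longrightarrow> 0 < m2) \<and>
           [poly F \<mu>1 = 0] (mod m1) \<and> [poly F \<mu>2 = 0] (mod m2) \<and>
           coset_equations a1 (\<beta> 1) (\<beta> l) (\<beta>bar l) (B l) c
             (pluecker_coset (column 1 (matcomb (B l) c)) (row 3 (matcomb (B' l) c')))
             m1 m2 \<mu>1 \<mu>2"
    if "l \<in> {1..h}" "admissible Dom (\<beta> l) (\<beta>bar l) (B l) (B' l) c c'" for l c c'
    unfolding F basis1
    using ideal_bases.admissible_imp_coset_equations[OF bases[OF that(1)] that(2)] .
  show ?thesis
    by (intro conjI ballI allI impI; (elim conjE)?; (rule part1 part2; assumption))
qed

end
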